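(* Let $j\ge5$ be an integer and let $f(u)=u^{j}+f_{j}(u)$, where $f_j:\mathbb{R}\to\mathbb{R}$ is of class $C^{j}$ and $\lim_{s\to0}f_j(s)/|s|^{j}=0$. There exists a small $\epsilon=\epsilon(j;f_j)>0$ such that the following holds. If $$u\in C(\mathbb{R}:H^{1,1/2}(\mathbb{R}))\cap L^\infty(\mathbb{R}:H^1(\mathbb{R}))$$ is a non-trivial (i.e. not identically zero) real-valued strong solution of $$\partial_t u+\partial_x(\partial_x^2u+f(u))=0,\qquad (t,x)\in\mathbb{R}\times\mathbb{R},$$ with $$\sup_{t\in\mathbb{R}}\|u(t)\|_{H^1}<\epsilon,$$ then $u=u(t,x)$ is not a time periodic solution (i.e. there is no $\omega>0$ with $u(t+\omega,x)=u(t,x)$ for all $t,x$).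
   Context: For $s,r\ge 0$, $H^{s,r}(\mathbb{R}):=H^s(\mathbb{R})\cap L^2(|x|^{2r}dx)$. "Strong solution" of the initial value problem (with $u(0,\cdot)=u_0$) has its standard meaning: $u$ is a continuous function of time with values in the stated space and satisfies the equation with this initial datum. *)

theory Defs
  imports "HOL-Analysis.Analysis"
begin

text \<open>
  Elements of Lebesgue and Sobolev spaces are given by Borel representatives; statements about
  them are meant up to Lebesgue null sets.
\<close>

definition class_C :: "nat \<Rightarrow> (real \<Rightarrow> real) \<Rightarrow> bool" where
  "class_C k f \<longleftrightarrow>
     (\<forall>i<k. \<forall>x. (deriv ^^ i) f differentiable (at x)) \<and> continuous_on UNIV ((deriv ^^ k) f)"

definition test_function :: "(real \<Rightarrow> real) \<Rightarrow> bool" where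
  "test_function \<phi> \<longleftrightarrow> (\<forall>k. class_C k \<phi>) \<and> (\<exists>R. \<forall>x. \<bar>x\<bar> > R \<longrightarrow> \<phi> x = 0)"

definition in_L2 :: "(real \<Rightarrow> real) \<Rightarrow> bool" where
  "in_L2 v \<longleftrightarrow> v \<in> borel_measurable borel \<and> integrable lborel (\<lambda>x. (v x)\<^sup>2)"

definition L2_norm :: "(real \<Rightarrow> real) \<Rightarrow> real" where
  "L2_norm v = sqrt (LINT x|lborel. (v x)\<^sup>2)"

text \<open>Only used for \<open>v\<close> and \<open>g\<close> in \<open>L\<^sup>2\<close>, so that both integrals exist.\<close>

definition is_weak_derivative :: "(real \<Rightarrow> real) \<Rightarrow> (real \<Rightarrow> real) \<Rightarrow> bool" where
  "is_weak_derivative v g \<longleftrightarrow>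
     (\<forall>\<phi>. test_function \<phi> \<longrightarrow>
        (LINT x|lborel. v x * deriv \<phi> x) = - (LINT x|lborel. g x * \<phi> x))"

definition in_H1 :: "(real \<Rightarrow> real) \<Rightarrow> bool" where
  "in_H1 v \<longleftrightarrow> in_L2 v \<and> (\<exists>g. in_L2 g \<and> is_weak_derivative v g)"

text \<open>The weak derivative of an \<open>H\<^sup>1\<close> function is unique up to null sets.\<close>

definition weak_derivative :: "(real \<Rightarrow> real) \<Rightarrow> real \<Rightarrow> real" where
  "weak_derivative v = (SOME g. in_L2 g \<and> is_weak_derivative v g)"

definition H1_norm :: "(real \<Rightarrow> real) \<Rightarrow> real" where
  "H1_norm v = sqrt ((L2_norm v)\<^sup>2 + (L2_norm (weak_derivative v))\<^sup>2)"

text \<open>The space \<open>H\<^sup>1(\<real>) \<inter> L\<^sup>2(\<bar>x\<bar>\<^bsup>2r\<^esup> dx)\<close> with its intersection norm.\<close>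

definition in_H1_weighted :: "real \<Rightarrow> (real \<Rightarrow> real) \<Rightarrow> bool" where
  "in_H1_weighted r v \<longleftrightarrow>
     in_H1 v \<and> integrable lborel (\<lambda>x. (v x)\<^sup>2 * \<bar>x\<bar> powr (2 * r))"

definition H1_weighted_norm :: "real \<Rightarrow> (real \<Rightarrow> real) \<Rightarrow> real" where
  "H1_weighted_norm r v =
     H1_norm v + sqrt (LINT x|lborel. (v x)\<^sup>2 * \<bar>x\<bar> powr (2 * r))"

definition continuous_in_H1_weighted :: "real \<Rightarrow> (real \<Rightarrow> real \<Rightarrow> real) \<Rightarrow> bool" where
  "continuous_in_H1_weighted r u \<longleftrightarrow>
     (\<forall>t. in_H1_weighted r (u t)) \<and>
     (\<forall>t. ((\<lambda>s. H1_weighted_norm r (\<lambda>x. u s x - u t x)) \<longlongrightarrow> 0) (at t))"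

text \<open>
  Essential boundedness in time. Strong measurability of \<open>u\<close> as an \<open>H\<^sup>1\<close>-valued map is not
  demanded here, as the predicate is only used for \<open>u\<close> continuous into \<open>H\<^sup>1\<close>.
\<close>

definition essentially_bounded_in_H1 :: "(real \<Rightarrow> real \<Rightarrow> real) \<Rightarrow> bool" where
  "essentially_bounded_in_H1 u \<longleftrightarrow>
     (\<forall>t. in_H1 (u t)) \<and> (\<exists>M. AE t in lborel. H1_norm (u t) \<le> M)"

text \<open>
  The equation \<open>u\<^sub>t + (u\<^sub>x\<^sub>x + f(u))\<^sub>x = 0\<close> at every time, in the sense of distributions in \<open>x\<close>:
  \<open>d/dt \<langle>u(t), \<phi>\<rangle> = \<langle>u(t), \<phi>'''\<rangle> + \<langle>f(u(t)), \<phi>'\<rangle>\<close>, the signs coming from three, respectively one,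
  integrations by parts. For \<open>u\<close> continuous into \<open>H\<^sup>1\<close> and \<open>f\<close> of class \<open>C\<^sup>1\<close> the right-hand side is
  continuous in \<open>t\<close>, so this is the same as the equation in the sense of distributions in
  \<open>(t,x)\<close>, or in \<open>H\<^bsup>-2\<^esup>\<close> for every \<open>t\<close>.
\<close>

definition solves_gKdV :: "(real \<Rightarrow> real) \<Rightarrow> (real \<Rightarrow> real \<Rightarrow> real) \<Rightarrow> bool" where
  "solves_gKdV f u \<longleftrightarrow>
     (\<forall>\<phi>. test_function \<phi> \<longrightarrow>
       (\<forall>t. ((\<lambda>s. LINT x|lborel. u s x * \<phi> x) has_real_derivative
               (LINT x|lborel. u t x * (deriv ^^ 3) \<phi> x + f (u t x) * deriv \<phi> x)) (at t)))"

definition strong_solution ::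
  "real \<Rightarrow> (real \<Rightarrow> real) \<Rightarrow> (real \<Rightarrow> real) \<Rightarrow> (real \<Rightarrow> real \<Rightarrow> real) \<Rightarrow> bool" where
  "strong_solution r f u\<^sub>0 u \<longleftrightarrow>
     continuous_in_H1_weighted r u \<and> solves_gKdV f u \<and> (AE x in lborel. u 0 x = u\<^sub>0 x)"

definition time_periodic :: "(real \<Rightarrow> real \<Rightarrow> real) \<Rightarrow> bool" where
  "time_periodic u \<longleftrightarrow> (\<exists>\<omega>>0. \<forall>t. AE x in lborel. u (t + \<omega>) x = u t x)"

definition identically_zero :: "(real \<Rightarrow> real \<Rightarrow> real) \<Rightarrow> bool" where
  "identically_zero u \<longleftrightarrow> (\<forall>t. AE x in lborel. u t x = 0)"

end

theory Submission
  imports Defs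
begin

text \<open>
  Formally, \<open>1/2 d/dt \<integral>x u\<^sup>2 = -3/2 \<integral>u\<^sub>x\<^sup>2 + \<integral>(u f(u) - F(u))\<close> with \<open>F' = f\<close>. As \<open>j \<ge> 5\<close>, the last
  integrand is \<open>O(u\<^sup>6)\<close> for small \<open>u\<close>, and \<open>\<integral>u\<^sup>6 \<le> C (\<integral>u\<^sup>2)\<^sup>2 \<integral>u\<^sub>x\<^sup>2\<close>, so for small solutions the left-hand
  integral is strictly decreasing unless \<open>u\<close> vanishes, which excludes periodicity.

  To make this rigorous, \<open>u\<close> is mollified in \<open>x\<close>, \<open>x\<close> is replaced by a compactly supported weight \<open>p\<close> with
  \<open>p' = \<zeta>\<^sup>2 + O(1/R)\<close> for a cut-off \<open>\<zeta>\<close> at scale \<open>R\<close>, and the identity is integrated over one period. The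
  sixth power is absorbed by a localized Gagliardo--Nirenberg inequality, and the commutator of
  mollification with \<open>f\<close> is uniformly small because \<open>H\<^sup>1\<close> functions are uniformly Hoelder continuous.
  Removing first the mollification and then the cut-off gives \<open>\<integral>u\<^sup>4 dt = 0\<close> over a period, at every \<open>x\<close>.
\<close>

section \<open>Smooth functions and mollifiers\<close>

text \<open>The formal computation differentiates u three times, while u(t) is only in H^1 and the
  equation is only known against test functions in x. Testing with y |-> k(x-y) yields v = k * u
  with v_t + v_xxx + q_x = 0 at every point, where q = k * f(u); the only error of mollification is
  q - f(v). It is multiplied by (pv)_x, and p has size about R. This fixes the order of limits: the
  weight stays fixed while the mollification is removed, uniformly in time because all u(t) share
  one Hoelder constant \<epsilon>; only then R tends to infinity. The lower bound is stated not for
  the dissipation \<integral>\<zeta>^2 v_x^2 but for (\<zeta> v^2)^2 at one point x, which the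
  interpolation inequality controls by that dissipation. Such point values survive both limits, so
  derivatives need not converge. The threshold \<epsilon> is independent of R and of the kernel: 2
  \<epsilon> <= s0 keeps u where the nonlinear bound holds, and \<epsilon> <= 1/4 makes the squared
  L^2 norms of v and v_x at most 1/16, which is what absorbing the sixth power requires.\<close>

lemma class_C_Suc:
  "class_C (Suc k) f \<longleftrightarrow> (\<forall>x. f differentiable (at x)) \<and> class_C k (deriv f)"
  by (simp add: class_C_def All_less_Suc2 funpow_Suc_right del: funpow.simps)

lemma class_C_0 [simp]: "class_C 0 f \<longleftrightarrow> continuous_on UNIV f"
  by (simp add: class_C_def)

lemma class_C_SucI:
  assumes "\<And>x. (f has_real_derivative g x) (at x)" "class_C k g"
  shows "class_C (Suc k) f"
proof -
  have "deriv f = g" using assms(1) by (auto intro: DERIV_imp_deriv)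
  then show ?thesis using assms by (auto simp: class_C_Suc real_differentiable_def)
qed

lemma class_C_Suc_DERIV: "class_C (Suc k) f \<Longrightarrow> (f has_real_derivative deriv f x) (at x)"
  unfolding class_C_Suc by (metis DERIV_deriv_iff_real_differentiable)

lemma class_C_imp_continuous: "class_C k f \<Longrightarrow> continuous_on UNIV f"
proof (cases k)
  case (Suc n)
  assume "class_C k f"
  then show ?thesis using Suc class_C_Suc_DERIV
    by (metis DERIV_isCont continuous_at_imp_continuous_on)
qed simp

lemma class_C_Suc_imp: "class_C (Suc k) f \<Longrightarrow> class_C k f"
proof (induction k arbitrary: f)
  case 0 then show ?case using class_C_imp_continuous by simp
next
  case (Suc k) then show ?case by (metis class_C_Suc)
qed

lemma class_C_add:
  assumes "class_C k f" "class_C k g"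
  shows "class_C k (\<lambda>x. f x + g x)"
  using assms
proof (induction k arbitrary: f g)
  case 0 then show ?case by (auto intro: continuous_intros)
next
  case (Suc k)
  show ?case
    by (rule class_C_SucI[of _ "\<lambda>x. deriv f x + deriv g x"])
       (use Suc class_C_Suc_DERIV in \<open>auto intro!: derivative_eq_intros simp: class_C_Suc\<close>)
qed

lemma class_C_mult:
  assumes "class_C k f" "class_C k g"
  shows "class_C k (\<lambda>x. f x * g x)"
  using assms
proof (induction k arbitrary: f g)
  case 0 then show ?case by (auto intro: continuous_intros)
next
  case (Suc k)
  have "class_C k f" "class_C k g" "class_C k (deriv f)" "class_C k (deriv g)"
    using Suc.prems class_C_Suc class_C_Suc_imp by blast+
  then have "class_C k (\<lambda>x. deriv f x * g x + f x * deriv g x)"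
    by (intro class_C_add Suc.IH)
  then show ?case
    by (rule class_C_SucI[rotated])
       (use Suc.prems class_C_Suc_DERIV in \<open>auto intro!: derivative_eq_intros\<close>)
qed

lemma class_C_const: "class_C k (\<lambda>x. c)"
proof (induction k arbitrary: c)
  case (Suc k)
  show ?case by (rule class_C_SucI[of _ "\<lambda>x. 0"]) (auto intro: Suc)
qed simp

lemma class_C_affine:
  assumes "class_C k f"
  shows "class_C k (\<lambda>x. f (a * x + b))"
  using assms
proof (induction k arbitrary: f)
  case 0 then show ?case
    by (auto intro!: continuous_on_compose2[of UNIV f] continuous_intros)
next
  case (Suc k)
  have "class_C k (\<lambda>x. a * deriv f (a * x + b))"
    using Suc by (intro class_C_mult class_C_const) (auto simp: class_C_Suc)
  then show ?case
  proof (rule class_C_SucI[rotated])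
    fix x
    show "((\<lambda>x. f (a * x + b)) has_real_derivative a * deriv f (a * x + b)) (at x)"
      by (rule DERIV_cong[OF DERIV_chain2[OF class_C_Suc_DERIV[OF Suc.prems], where x = x and g = "\<lambda>x. a * x + b" and Db = a]])
         (auto intro!: derivative_eq_intros)
  qed
qed

section \<open>Flat exponentials and compactly supported bumps\<close>

lemma poly_times_exp_minus_tendsto_0: "((\<lambda>y. poly p y * exp (- y)) \<longlongrightarrow> (0::real)) at_top"
proof -
  have "((\<lambda>y. \<Sum>i\<le>degree p. coeff p i * (y ^ i / exp y)) \<longlongrightarrow> (\<Sum>i\<le>degree p. coeff p i * 0)) at_top"
    by (intro tendsto_intros tendsto_power_div_exp_0)
  then show ?thesis
    by (simp add: poly_altdef exp_minus sum_distrib_right divide_inverse mult.assoc)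
qed

text \<open>
  Differentiating \<open>exp (-1/x)\<close> produces polynomial factors in \<open>1/x\<close>; with these included the family is
  closed under derivatives.
\<close>

definition flat_exp :: "real poly \<Rightarrow> real \<Rightarrow> real" where
  "flat_exp p x = (if x > 0 then poly p (1/x) * exp (- (1/x)) else 0)"

text \<open>For x > 0 the derivative of p(1/x) exp(-1/x) is (1/x)^2 (p - p')(1/x) exp(-1/x), and
  \<open>monom 1 2 * (p - pderiv p)\<close> is that polynomial in 1/x. Only x = 0 needs an argument:
  there the exponential beats every power of 1/x.\<close>

lemma flat_exp_DERIV:
  "(flat_exp p has_real_derivative flat_exp (monom 1 2 * (p - pderiv p)) x) (at x)"
proof -
  consider "x < 0" | "x = 0" | "x > 0" by linarith
  then show ?thesis
  proof cases
    case 1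
    have "((\<lambda>x. 0) has_real_derivative 0) (at x)" by simp
    moreover have "eventually (\<lambda>y. y < 0) (nhds x)" using 1 eventually_nhds_in_open[of "{..<0}" x] by simp
    ultimately show ?thesis using 1
      by (subst DERIV_cong_ev[of x x "flat_exp p" "\<lambda>x. 0"])
         (auto simp: flat_exp_def elim!: eventually_mono)
  next
    case 3
    have "((\<lambda>x. poly p (1/x) * exp (- (1/x))) has_real_derivative
        (poly (pderiv p) (1/x) * (-1/x^2)) * exp (-(1/x)) + exp (-(1/x)) * (1/x^2) * poly p (1/x)) (at x)"
      using 3
      by (auto intro!: derivative_eq_intros DERIV_chain2[OF poly_DERIV] simp: power2_eq_square field_simps)
    moreover have "eventually (\<lambda>y. y > 0) (nhds x)" using 3 eventually_nhds_in_open[of "{0<..}" x] by simp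
    ultimately show ?thesis using 3
      by (subst DERIV_cong_ev[of x x "flat_exp p" "\<lambda>x. poly p (1/x) * exp (- (1/x))"])
         (auto simp: flat_exp_def poly_monom field_simps elim!: eventually_mono)
  next
    case 2
    have "((\<lambda>y. (flat_exp p y - flat_exp p 0) / (y - 0)) \<longlongrightarrow> 0) (at 0)"
    proof (rule filterlim_split_at)
      have "eventually (\<lambda>y. y < 0) (at_left (0::real))" by (simp add: eventually_at_filter)
      then show "((\<lambda>y. (flat_exp p y - flat_exp p 0) / (y - 0)) \<longlongrightarrow> 0) (at_left 0)"
        by (intro tendsto_eventually) (auto simp: flat_exp_def elim!: eventually_mono)
      \<comment> \<open>The difference quotient at 0 is p(1/y) exp(-1/y) / y; the extra factor 1/y
        turns p into \<open>pCons 0 p\<close>.\<close>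
      have "((\<lambda>y. poly (pCons 0 p) (inverse y) * exp (- inverse y)) \<longlongrightarrow> 0) (at_right (0::real))"
        using filterlim_compose[OF poly_times_exp_minus_tendsto_0 filterlim_inverse_at_top_right] .
      moreover have "eventually (\<lambda>y. y > 0) (at_right (0::real))" by (simp add: eventually_at_filter)
      ultimately show "((\<lambda>y. (flat_exp p y - flat_exp p 0) / (y - 0)) \<longlongrightarrow> 0) (at_right 0)"
        by (elim Lim_transform_eventually)
           (auto simp: flat_exp_def field_simps elim!: eventually_mono)
    qed
    then show ?thesis using 2 by (simp add: has_field_derivative_iff flat_exp_def)
  qed
qed

lemma class_C_flat_exp: "class_C k (flat_exp p)"
proof (induction k arbitrary: p)
  case 0 then show ?case
    using flat_exp_DERIV by (metis DERIV_isCont class_C_0 continuous_at_imp_continuous_on)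
next
  case (Suc k)
  then show ?case using flat_exp_DERIV class_C_SucI by blast
qed

lemma bump_function_exists:
  "\<exists>b::real \<Rightarrow> real. (\<forall>n. class_C n b) \<and> (\<forall>x. 0 \<le> b x) \<and> (\<forall>x. 1 \<le> \<bar>x\<bar> \<longrightarrow> b x = 0) \<and> 0 < b 0"
proof (intro exI conjI allI impI)
  \<comment> \<open>On (-1,1) this is exp(-1/(1+x) - 1/(1-x)); elsewhere one of the two factors
    vanishes.\<close>
  let ?b = "\<lambda>x. flat_exp 1 (1 * x + 1) * flat_exp 1 (-1 * x + 1)"
  show "class_C n ?b" for n by (intro class_C_mult class_C_affine class_C_flat_exp)
qed (auto simp: flat_exp_def)

definition mollifier :: "real \<Rightarrow> (real \<Rightarrow> real) \<Rightarrow> bool" where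
  "mollifier \<delta> k \<longleftrightarrow> (\<forall>n. class_C n k) \<and> (\<forall>x. 0 \<le> k x) \<and> (\<forall>x. \<delta> \<le> \<bar>x\<bar> \<longrightarrow> k x = 0) \<and>
     (LINT x|lborel. k x) = 1"

lemma integrable_compact_support_Icc:
  fixes f :: "real \<Rightarrow> real"
  assumes "continuous_on UNIV f" "\<And>x. x \<notin> {a..b} \<Longrightarrow> f x = 0"
  shows "integrable lborel f" "(LINT x|lborel. f x) = integral {a..b} f"
proof -
  have eq: "f = (\<lambda>x. indicator {a..b} x * f x)"
  proof
    fix x show "f x = indicator {a..b} x * f x"
      using assms(2)[of x] by (cases "x \<in> {a..b}") auto
  qed
  have i: "set_integrable lborel {a..b} f"
    by (rule borel_integrable_atLeastAtMost')
       (use assms(1) in \<open>auto intro: continuous_on_subset\<close>)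
  show "integrable lborel f"
    using i eq by (simp add: set_integrable_def)
  show "(LINT x|lborel. f x) = integral {a..b} f"
    using set_borel_integral_eq_integral(2)[OF i] eq by (simp add: set_lebesgue_integral_def)
qed

lemma integrable_compact_support:
  fixes f :: "real \<Rightarrow> real"
  assumes "continuous_on UNIV f" "\<And>x. R < \<bar>x\<bar> \<Longrightarrow> f x = 0"
  shows "integrable lborel f" "(LINT x|lborel. f x) = integral {-R..R} f"
proof -
  have "f x = 0" if "x \<notin> {-R..R}" for x
    by (rule assms(2)) (use that in \<open>auto simp: abs_if\<close>)
  from integrable_compact_support_Icc[OF assms(1) this]
  show "integrable lborel f" "(LINT x|lborel. f x) = integral {-R..R} f" by blast+
qed

text \<open>It is the square of \<open>b\<close> that is normalized: the virial weight will have
  slope b(x/R)^2 up to O(1/R), and the cut-off b(x/R), a square root of that slope, must itself be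
  differentiable.\<close>

lemma unit_bump_exists:
  obtains b :: "real \<Rightarrow> real" where "\<And>n. class_C n b" "\<And>x. 0 \<le> b x" "0 < b 0"
    "mollifier 1 (\<lambda>x. (b x)\<^sup>2)"
proof -
  obtain c :: "real \<Rightarrow> real" where c: "\<And>n. class_C n c" "\<And>x. 0 \<le> c x" "\<And>x. 1 \<le> \<bar>x\<bar> \<Longrightarrow> c x = 0" "0 < c 0"
    using bump_function_exists by metis
  define I where "I = (LINT x|lborel. (c x)\<^sup>2)"
  have cc: "continuous_on UNIV (\<lambda>x. (c x)\<^sup>2)"
    by (intro continuous_intros class_C_imp_continuous[OF c(1)])
  have I: "I = integral {-1..1} (\<lambda>x. (c x)\<^sup>2)"
    unfolding I_def by (rule integrable_compact_support(2)[OF cc]) (use c(3) in auto)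
  have "I \<noteq> 0"
  proof
    assume "I = 0"
    then have "\<forall>x\<in>{-1..1}. (c x)\<^sup>2 = 0"
      using integral_eq_0_iff[of "-1" 1 "\<lambda>x. (c x)\<^sup>2"] I continuous_on_subset[OF cc] by auto
    then show False using c(4) by force
  qed
  moreover have "I \<ge> 0" by (simp add: I_def)
  ultimately have I0: "I > 0" by simp
  define b where "b x = (1 / sqrt I) * c x" for x
  have b2: "(b x)\<^sup>2 = (c x)\<^sup>2 / I" for x
    using I0 by (simp add: b_def power_mult_distrib power_divide)
  have bC: "class_C n b" for n
    unfolding b_def by (intro class_C_mult class_C_const c(1))
  show thesis
  proof (rule that[OF bC])
    show "0 \<le> b x" for x using c(2) I0 by (simp add: b_def)
    show "0 < b 0" using c(4) I0 by (simp add: b_def)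
    have "class_C n (\<lambda>x. (b x)\<^sup>2)" for n
      unfolding power2_eq_square by (intro class_C_mult bC)
    then show "mollifier 1 (\<lambda>x. (b x)\<^sup>2)"
      unfolding mollifier_def using I0 c(3) by (auto simp: b2 I_def[symmetric])
  qed
qed

lemma mollifier_exists:
  assumes "\<delta> > 0"
  obtains k where "mollifier \<delta> k"
proof -
  obtain b :: "real \<Rightarrow> real" where b: "\<And>n. class_C n b" "\<And>x. 0 \<le> b x" "0 < b 0"
    "mollifier 1 (\<lambda>x. (b x)\<^sup>2)"
    using unit_bump_exists by blast
  define k where "k x = (1 / \<delta>) * (b (1 / \<delta> * x + 0) * b (1 / \<delta> * x + 0))" for x
  have "class_C n k" for n
    unfolding k_def by (intro class_C_mult class_C_const class_C_affine b(1))
  moreover have "(LINT x|lborel. k x) = 1"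
    using lborel_integral_real_affine[of \<delta> k 0] b(4) assms
    by (simp add: k_def mollifier_def power2_eq_square)
  moreover have "k x = 0" if "\<delta> \<le> \<bar>x\<bar>" for x
  proof -
    have "1 \<le> \<bar>x / \<delta>\<bar>" using that assms by (simp add: abs_divide)
    then have "(b (x / \<delta>))\<^sup>2 = 0" using b(4) unfolding mollifier_def by blast
    then show ?thesis by (simp add: k_def)
  qed
  ultimately have "mollifier \<delta> k"
    using assms by (auto simp: mollifier_def k_def)
  then show thesis by (rule that)
qed

section \<open>Square-integrable functions and convolution\<close>

lemma indicator_times_integrable:
  fixes f :: "real \<Rightarrow> real"
  assumes "integrable lborel f" "A \<in> sets borel"
  shows "integrable lborel (\<lambda>x. indicator A x * f x)"
  using integrable_mult_indicator[of A lborel f] assms by simp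

text \<open>On [-n,n], the positive and negative parts of \<open>h\<close> are densities of finite
  measures. These agree on all half-lines, hence coincide, and so do their densities almost
  everywhere.\<close>

lemma AE_zero_if_integral_zero_on_intervals:
  fixes h :: "real \<Rightarrow> real"
  assumes int: "\<And>a b. set_integrable lborel {a..b} h"
    and zero: "\<And>a b. a \<le> b \<Longrightarrow> (LINT x:{a..b}|lborel. h x) = 0"
  shows "AE x in lborel. h x = 0"
proof -
  have zero': "(LINT x:{a..b}|lborel. h x) = 0" for a b
    using zero[of a b] by (cases "a \<le> b") (auto simp: set_lebesgue_integral_def)
  have "AE x in lborel. indicator {-real n..real n} x * h x = 0" for n
  proof -
    define hn where "hn = (\<lambda>x. indicator {-real n..real n} x * h x)"
    have hn: "integrable lborel hn"
      using int[of "-real n" "real n"] by (simp add: set_integrable_def hn_def)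
    have [measurable]: "hn \<in> borel_measurable borel" using hn by auto
    have ip: "integrable lborel (\<lambda>x. max 0 (hn x))" "integrable lborel (\<lambda>x. max 0 (- hn x))"
      using hn by auto
    have fin: "emeasure (density lborel (\<lambda>x. ennreal (max 0 (g x)))) {c<..} =
        ennreal (LINT x|lborel. indicator {c<..} x * max 0 (g x))"
      if g: "integrable lborel g" for g :: "real \<Rightarrow> real" and c
    proof -
      have [measurable]: "g \<in> borel_measurable borel" using g by auto
      have "emeasure (density lborel (\<lambda>x. ennreal (max 0 (g x)))) {c<..} =
         (\<integral>\<^sup>+x. ennreal (indicator {c<..} x * max 0 (g x)) \<partial>lborel)"
        by (subst emeasure_density) (auto intro!: nn_integral_cong simp: indicator_def)
      also have "\<dots> = ennreal (LINT x|lborel. indicator {c<..} x * max 0 (g x))"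
        by (intro nn_integral_eq_integral indicator_times_integrable greaterThan_borel integrable_max Bochner_Integration.integrable_zero g) auto
      finally show ?thesis .
    qed
    have eq: "(LINT x|lborel. indicator {c<..} x * max 0 (hn x)) =
       (LINT x|lborel. indicator {c<..} x * max 0 (- hn x))" for c
    proof -
      have "(LINT x|lborel. indicator {c<..} x * max 0 (hn x)) - (LINT x|lborel. indicator {c<..} x * max 0 (- hn x))
        = (LINT x|lborel. indicator {c<..} x * max 0 (hn x) - indicator {c<..} x * max 0 (- hn x))"
        by (intro Bochner_Integration.integral_diff[symmetric] indicator_times_integrable ip greaterThan_borel)
      also have "\<dots> = (LINT x:{max c (-real n)..real n}|lborel. h x)"
        unfolding set_lebesgue_integral_def
      proof (rule integral_cong_AE)
        show "AE x in lborel. indicator {c<..} x * max 0 (hn x) - indicator {c<..} x * max 0 (- hn x) =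
            indicator {max c (- real n)..real n} x *\<^sub>R h x"
          \<comment> \<open>The half-line is open at c and the interval closed there, so the
            integrands may differ at c.\<close>
          using AE_lborel_singleton[of c]
          by eventually_elim (auto simp: hn_def indicator_def)
        show "(\<lambda>x. indicator {max c (- real n)..real n} x *\<^sub>R h x) \<in> borel_measurable lborel"
          using int[of "max c (-real n)" "real n"] by (auto simp: set_integrable_def)
      qed auto
      also have "\<dots> = 0" by (rule zero')
      finally show ?thesis by simp
    qed
    have "density lborel (\<lambda>x. ennreal (max 0 (hn x))) = density lborel (\<lambda>x. ennreal (max 0 (- hn x)))"
    proof (rule measure_eqI_lessThan)
      fix c
      show "emeasure (density lborel (\<lambda>x. ennreal (max 0 (hn x)))) {c<..} < \<infinity>"
        using fin[OF hn] by simp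
      show "emeasure (density lborel (\<lambda>x. ennreal (max 0 (hn x)))) {c<..} =
        emeasure (density lborel (\<lambda>x. ennreal (max 0 (- hn x)))) {c<..}"
        using fin[OF hn] fin[of "\<lambda>x. - hn x"] hn eq by auto
    qed auto
    then have "AE x in lborel. ennreal (max 0 (hn x)) = ennreal (max 0 (- hn x))"
      by (subst (asm) sigma_finite_measure.density_unique_iff[OF sigma_finite_lborel]) auto
    then have "AE x in lborel. hn x = 0"
      by eventually_elim (auto simp: max_def split: if_splits)
    then show ?thesis by (simp add: hn_def)
  qed
  then have "AE x in lborel. \<forall>n. indicator {-real n..real n} x * h x = 0"
    unfolding AE_all_countable by blast
  then show ?thesis
  proof eventually_elim
    fix x assume "\<forall>n. indicator {-real n..real n} x * h x = 0"
    moreover obtain n where "\<bar>x\<bar> \<le> real n" using real_arch_simple by blast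
    ultimately show "h x = 0" by (auto simp: indicator_def abs_le_iff split: if_splits dest!: spec[of _ n])
  qed
qed

text \<open>The set of disagreement is open; if nonempty, it would contain a ball of positive
  measure.\<close>

lemma continuous_AE_eq_imp_eq:
  fixes f g :: "real \<Rightarrow> real"
  assumes "continuous_on UNIV f" "continuous_on UNIV g" "AE x in lborel. f x = g x"
  shows "f x = g x"
proof (rule ccontr)
  assume ne: "f x \<noteq> g x"
  have op: "open {x. f x \<noteq> g x}"
    by (rule open_Collect_neq) (use assms in auto)
  then obtain e where e: "e > 0" "cball x e \<subseteq> {x. f x \<noteq> g x}"
    using ne open_contains_cball by blast
  have "{x. f x \<noteq> g x} \<in> null_sets lborel"
    using assms(3) op by (subst (asm) AE_iff_null) auto
  then have "cball x e \<in> null_sets lborel"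
    by (rule null_sets_subset) (use e in auto)
  then show False using e by (simp add: null_sets_def cball_eq_atLeastAtMost)
qed

section \<open>Pairings and norms in L^2\<close>

lemma in_L2_mult_integrable:
  assumes "in_L2 f" "in_L2 g"
  shows "integrable lborel (\<lambda>x. f x * g x)"
proof (rule Bochner_Integration.integrable_bound)
  show "integrable lborel (\<lambda>x. (f x)\<^sup>2 + (g x)\<^sup>2)" using assms by (auto simp: in_L2_def)
  show "(\<lambda>x. f x * g x) \<in> borel_measurable lborel" using assms by (auto simp: in_L2_def)
  have "\<bar>a * b\<bar> \<le> a\<^sup>2 + b\<^sup>2" for a b :: real
  proof -
    have "2 * (\<bar>a\<bar> * \<bar>b\<bar>) \<le> a\<^sup>2 + b\<^sup>2" "0 \<le> \<bar>a\<bar> * \<bar>b\<bar>"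
      using sum_squares_bound[of "\<bar>a\<bar>" "\<bar>b\<bar>"] by auto
    then show ?thesis unfolding abs_mult by linarith
  qed
  then show "AE x in lborel. norm (f x * g x) \<le> norm ((f x)\<^sup>2 + (g x)\<^sup>2)" by auto
qed

lemma L2_norm_nonneg [simp]: "0 \<le> L2_norm v"
  by (simp add: L2_norm_def)

lemma L2_norm_power2: "(L2_norm v)\<^sup>2 = (LINT x|lborel. (v x)\<^sup>2)"
  by (simp add: L2_norm_def)

lemma L2_Cauchy_Schwarz:
  assumes f: "in_L2 f" and g: "in_L2 g"
  shows "\<bar>LINT x|lborel. f x * g x\<bar> \<le> L2_norm f * L2_norm g"
proof -
  define p q r where "p = (LINT x|lborel. (f x)\<^sup>2)" and "q = (LINT x|lborel. (g x)\<^sup>2)"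
    and "r = (LINT x|lborel. f x * g x)"
  have nn: "p \<ge> 0" "q \<ge> 0" by (auto simp: p_def q_def)
  have quad: "0 \<le> s\<^sup>2 * p + 2 * s * t * r + t\<^sup>2 * q" for s t
  proof -
    have "0 \<le> (LINT x|lborel. (s * f x + t * g x)\<^sup>2)" by simp
    also have "\<dots> = (LINT x|lborel. s\<^sup>2 * (f x)\<^sup>2 + (2 * s * t) * (f x * g x) + t\<^sup>2 * (g x)\<^sup>2)"
      by (rule arg_cong) (auto simp: power2_eq_square algebra_simps)
    also have "\<dots> = s\<^sup>2 * p + 2 * s * t * r + t\<^sup>2 * q"
      using f g in_L2_mult_integrable[OF f g]
      by (simp add: p_def q_def r_def in_L2_def)
    finally show ?thesis .
  qed
  have "r\<^sup>2 \<le> p * q"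
  proof (cases "q = 0")
    case True
    have "r = 0"
    proof (rule ccontr)
      assume "r \<noteq> 0"
      \<comment> \<open>With q = 0 this choice of t makes the quadratic form equal to p - (p + 1) =
        -1.\<close>
      with quad[of 1 "- (p + 1) / (2 * r)"] True nn show False by (simp add: field_simps)
    qed
    then show ?thesis using nn True by simp
  next
    case False
    then have "q > 0" using nn by simp
    \<comment> \<open>At s = q, t = -r the quadratic form is q (p q - r^2).\<close>
    have "0 \<le> q * (p * q - r\<^sup>2)"
      using quad[of q "-r"] by (simp add: power2_eq_square algebra_simps)
    then show ?thesis using \<open>q > 0\<close> by (simp add: zero_le_mult_iff)
  qed
  then have "sqrt (r\<^sup>2) \<le> sqrt (p * q)" by (rule real_sqrt_le_mono)
  then show ?thesis by (simp add: L2_norm_def p_def q_def r_def real_sqrt_mult)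
qed

lemma in_L2_compact_support:
  fixes f :: "real \<Rightarrow> real"
  assumes "continuous_on UNIV f" "\<And>x. R < \<bar>x\<bar> \<Longrightarrow> f x = 0"
  shows "in_L2 f"
  unfolding in_L2_def using assms
  by (auto intro!: integrable_compact_support(1)[of _ R] continuous_intros borel_measurable_continuous_onI)

lemma in_L2_indicator: "in_L2 (indicator {a..b})"
proof -
  have "(indicator {a..b} x :: real)\<^sup>2 = indicator {a..b} x" for x by (simp add: indicator_def)
  then show ?thesis by (simp add: in_L2_def emeasure_lborel_Icc_eq)
qed

lemma in_L2_set_integrable: "in_L2 f \<Longrightarrow> set_integrable lborel {a..b} f"
  using in_L2_mult_integrable[OF in_L2_indicator, of f a b] by (simp add: set_integrable_def)

section \<open>Kernels, their primitives and convolution\<close>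

lemma mollifierD:
  assumes "mollifier \<delta> k"
  shows "class_C n k" "0 \<le> k x" "\<delta> \<le> \<bar>x\<bar> \<Longrightarrow> k x = 0" "(LINT x|lborel. k x) = 1"
    "continuous_on UNIV k" "\<delta> > 0" "integrable lborel k"
proof -
  show c: "continuous_on UNIV k" using assms class_C_imp_continuous mollifier_def by blast
  show "\<delta> > 0"
  proof (rule ccontr)
    assume "\<not> \<delta> > 0"
    then have "k x = 0" for x using assms by (auto simp: mollifier_def)
    then have "(LINT x|lborel. k x) = 0" by simp
    then show False using assms by (auto simp: mollifier_def)
  qed
  show "integrable lborel k"
    by (rule integrable_compact_support(1)[OF c, of \<delta>]) (use assms in \<open>auto simp: mollifier_def\<close>)
qed (use assms in \<open>auto simp: mollifier_def\<close>)

text \<open>A smooth step from 0 to 1. It serves to build test functions from two shifted steps, to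
  integrate convolutions over intervals, and as the profile of the virial weight.\<close>

lemma mollifier_antiderivative:
  assumes k: "mollifier \<delta> k"
  obtains K where "\<And>x. (K has_real_derivative k x) (at x)" "\<And>x. x \<le> -\<delta> \<Longrightarrow> K x = 0"
    "\<And>x. \<delta> \<le> x \<Longrightarrow> K x = 1" "\<And>x. 0 \<le> K x" "\<And>x. K x \<le> 1"
proof -
  note kD = mollifierD[OF k]
  have "isCont k x" for x using kD(5) continuous_on_eq_continuous_at by blast
  then obtain F where F: "\<And>x. (F has_vector_derivative k x) (at x)"
    using einterval_antiderivative[of "-\<infinity>" "\<infinity>" k] by auto
  define K where "K x = F x - F (-\<delta>)" for x
  have K': "(K has_real_derivative k x) (at x)" for x
    using F unfolding K_def has_real_derivative_iff_has_vector_derivative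
    by (auto intro!: derivative_eq_intros)
  have mono: "K x \<le> K y" if "x \<le> y" for x y
    using that by (rule DERIV_nonneg_imp_nondecreasing) (use K' kD(2) in blast)
  have const: "K x = K y" if xy: "x \<le> y" "\<And>z. x \<le> z \<Longrightarrow> z \<le> y \<Longrightarrow> k z = 0" for x y
  proof (rule antisym[OF mono[OF xy(1)]])
    show "K y \<le> K x" using xy(1)
      by (rule DERIV_nonpos_imp_nonincreasing) (use K' xy(2) in \<open>metis order.refl\<close>)
  qed
  have 0: "K x = 0" if "x \<le> -\<delta>" for x
  proof -
    have "K x = K (-\<delta>)" by (rule const) (use that kD(3) in auto)
    then show ?thesis by (simp add: K_def)
  qed
  have "(k has_integral K \<delta> - K (-\<delta>)) {-\<delta>..\<delta>}"
    by (rule fundamental_theorem_of_calculus)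
       (use kD(6) K' in \<open>auto simp: has_real_derivative_iff_has_vector_derivative[symmetric] intro: has_field_derivative_at_within\<close>)
  then have 1: "K \<delta> = 1"
    using integrable_compact_support(2)[OF kD(5), of \<delta>] kD(3,4) 0[of "-\<delta>"]
    by (auto simp: has_integral_iff)
  have 1: "K x = 1" if "x \<ge> \<delta>" for x
  proof -
    have "K \<delta> = K x" by (rule const) (use that kD(3) in auto)
    then show ?thesis using 1 by simp
  qed
  show thesis
  proof
    show "0 \<le> K x" for x using mono[of "min x (-\<delta>)" x] 0[of "min x (-\<delta>)"] by simp
    show "K x \<le> 1" for x using mono[of x "max x \<delta>"] 1[of "max x \<delta>"] by simp
  qed (use K' 0 1 in auto)
qed

definition conv :: "(real \<Rightarrow> real) \<Rightarrow> (real \<Rightarrow> real) \<Rightarrow> real \<Rightarrow> real" where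
  "conv k h x = (LINT y|lborel. k (x - y) * h y)"

lemma mollifier_reflect_integrals:
  assumes k: "mollifier \<delta> k"
  shows "in_L2 (\<lambda>y. k (x - y))" "integrable lborel (\<lambda>y. k (x - y))" "(LINT y|lborel. k (x - y)) = 1"
    "integrable lborel (\<lambda>x. k (x - y))" "(LINT x|lborel. k (x - y)) = 1"
proof -
  note kD = mollifierD[OF k]
  have "continuous_on UNIV (\<lambda>y. k (x - y))"
    by (intro continuous_on_compose2[OF kD(5)] continuous_intros) auto
  then show "in_L2 (\<lambda>y. k (x - y))"
    by (rule in_L2_compact_support[of _ "\<delta> + \<bar>x\<bar>"]) (auto intro!: kD(3))
  show "integrable lborel (\<lambda>y. k (x - y))"
    using lborel_integrable_real_affine[OF kD(7), of "-1" x] by simp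
  show "(LINT y|lborel. k (x - y)) = 1"
    using lborel_integral_real_affine[of "-1" k x] kD(4) by simp
  show "integrable lborel (\<lambda>x. k (x - y))"
    using lborel_integrable_real_affine[OF kD(7), of 1 "-y"] by simp
  show "(LINT x|lborel. k (x - y)) = 1"
    using lborel_integral_real_affine[of 1 k "-y"] kD(4) by simp
qed

text \<open>Jensen's inequality for the probability density k(x - y) dy, obtained as nonnegativity
  of the variance of \<open>h\<close> about its mean \<open>m\<close>.\<close>

lemma conv_power2_le:
  assumes k: "mollifier \<delta> k" and h: "in_L2 h"
  shows "integrable lborel (\<lambda>y. k (x - y) * (h y)\<^sup>2)"
    "(conv k h x)\<^sup>2 \<le> (LINT y|lborel. k (x - y) * (h y)\<^sup>2)"
proof -
  note kD = mollifierD[OF k]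
  note kr = mollifier_reflect_integrals[OF k]
  have "compact (k ` {-\<delta>..\<delta>})"
    by (intro compact_continuous_image continuous_on_subset[OF kD(5)]) auto
  then obtain B where B: "\<And>x. x \<in> {-\<delta>..\<delta>} \<Longrightarrow> \<bar>k x\<bar> \<le> B"
    by (meson bounded_real compact_imp_bounded imageI)
  then have "0 \<le> B" using kD(6) by fastforce
  have B: "\<bar>k x\<bar> \<le> B" for x
    using B[of x] kD(3)[of x] \<open>0 \<le> B\<close> by (cases "x \<in> {-\<delta>..\<delta>}") auto
  have [measurable]: "k \<in> borel_measurable borel" "h \<in> borel_measurable borel"
    using kD(5) h by (auto simp: in_L2_def borel_measurable_continuous_onI)
  show i2: "integrable lborel (\<lambda>y. k (x - y) * (h y)\<^sup>2)"
  proof (rule Bochner_Integration.integrable_bound)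
    show "integrable lborel (\<lambda>y. B * (h y)\<^sup>2)" using h by (auto simp: in_L2_def)
    show "AE y in lborel. norm (k (x - y) * (h y)\<^sup>2) \<le> norm (B * (h y)\<^sup>2)"
      using B \<open>0 \<le> B\<close> by (auto simp: abs_mult intro!: mult_right_mono)
  qed auto
  have i1: "integrable lborel (\<lambda>y. k (x - y) * h y)"
    using in_L2_mult_integrable[OF kr(1) h] .
  define m where "m = conv k h x"
  have "0 \<le> (LINT y|lborel. k (x - y) * (h y - m)\<^sup>2)"
    using kD(2) by (intro Bochner_Integration.integral_nonneg) auto
  also have "\<dots> = (LINT y|lborel. k (x - y) * (h y)\<^sup>2 - (2 * m) * (k (x - y) * h y) + m\<^sup>2 * k (x - y))"
    by (rule arg_cong) (auto simp: power2_eq_square algebra_simps)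
  also have "\<dots> = (LINT y|lborel. k (x - y) * (h y)\<^sup>2) - 2 * m * m + m\<^sup>2 * 1"
    using i1 i2 kr(2,3) by (simp add: m_def conv_def)
  finally show "(conv k h x)\<^sup>2 \<le> (LINT y|lborel. k (x - y) * (h y)\<^sup>2)"
    by (simp add: m_def power2_eq_square)
qed

text \<open>The pointwise Jensen bound is integrated in x; after Tonelli the inner integral of k(x -
  y) over x is 1. Nonnegative integrals are used because finiteness is part of the claim.\<close>

lemma conv_L2:
  assumes k: "mollifier \<delta> k" and h: "in_L2 h"
  shows "in_L2 (conv k h)" "L2_norm (conv k h) \<le> L2_norm h"
proof -
  note kD = mollifierD[OF k]
  note kr = mollifier_reflect_integrals[OF k]
  have [measurable]: "k \<in> borel_measurable borel" "h \<in> borel_measurable borel"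
    using kD(5) h by (auto simp: in_L2_def borel_measurable_continuous_onI)
  have m[measurable]: "conv k h \<in> borel_measurable borel"
    unfolding conv_def by measurable
  have ih: "integrable lborel (\<lambda>y. (h y)\<^sup>2)" using h by (simp add: in_L2_def)
  have "(\<integral>\<^sup>+x. ennreal ((conv k h x)\<^sup>2) \<partial>lborel) \<le> (\<integral>\<^sup>+x. (\<integral>\<^sup>+y. ennreal (k (x - y) * (h y)\<^sup>2) \<partial>lborel) \<partial>lborel)"
  proof (rule nn_integral_mono)
    fix x
    have "ennreal ((conv k h x)\<^sup>2) \<le> ennreal (LINT y|lborel. k (x - y) * (h y)\<^sup>2)"
      using conv_power2_le[OF k h] by (intro ennreal_leI) auto
    also have "\<dots> = (\<integral>\<^sup>+y. ennreal (k (x - y) * (h y)\<^sup>2) \<partial>lborel)"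
      using conv_power2_le[OF k h] kD(2) by (intro nn_integral_eq_integral[symmetric]) auto
    finally show "ennreal ((conv k h x)\<^sup>2) \<le> (\<integral>\<^sup>+y. ennreal (k (x - y) * (h y)\<^sup>2) \<partial>lborel)" .
  qed
  also have "\<dots> = (\<integral>\<^sup>+y. (\<integral>\<^sup>+x. ennreal (k (x - y) * (h y)\<^sup>2) \<partial>lborel) \<partial>lborel)"
    by (rule lborel_pair.Fubini') measurable
  also have "\<dots> = (\<integral>\<^sup>+y. ennreal ((h y)\<^sup>2) \<partial>lborel)"
  proof (rule nn_integral_cong)
    fix y
    have "(\<integral>\<^sup>+x. ennreal (k (x - y) * (h y)\<^sup>2) \<partial>lborel) = ennreal (LINT x|lborel. k (x - y) * (h y)\<^sup>2)"
      using kr kD(2) by (intro nn_integral_eq_integral) auto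
    then show "(\<integral>\<^sup>+x. ennreal (k (x - y) * (h y)\<^sup>2) \<partial>lborel) = ennreal ((h y)\<^sup>2)"
      using kr by simp
  qed
  also have "\<dots> = ennreal ((L2_norm h)\<^sup>2)"
    using ih by (simp add: nn_integral_eq_integral L2_norm_power2)
  finally have le: "(\<integral>\<^sup>+x. ennreal ((conv k h x)\<^sup>2) \<partial>lborel) \<le> ennreal ((L2_norm h)\<^sup>2)" .
  have i: "integrable lborel (\<lambda>x. (conv k h x)\<^sup>2)"
    by (rule integrableI_nonneg) (use le in \<open>auto simp: less_top[symmetric] top_unique\<close>)
  then show "in_L2 (conv k h)" using m by (simp add: in_L2_def)
  have "(L2_norm (conv k h))\<^sup>2 \<le> (L2_norm h)\<^sup>2"
    using le nn_integral_eq_integral[OF i] by (simp add: L2_norm_power2)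
  then show "L2_norm (conv k h) \<le> L2_norm h" by (rule power2_le_imp_le) simp
qed

section \<open>Continuous representatives of H1 functions\<close>

text \<open>The inequality is strict so that it persists near x; the endpoints |x| = R are not
  covered.\<close>

lemma deriv_eq_0_outside:
  fixes \<phi> :: "real \<Rightarrow> real"
  assumes \<phi>: "\<And>x. R < \<bar>x\<bar> \<Longrightarrow> \<phi> x = 0" and x: "R < \<bar>x\<bar>"
  shows "deriv \<phi> x = 0"
proof -
  have "eventually (\<lambda>y. R < \<bar>y\<bar>) (nhds x)"
    by (rule order_tendstoD(1)[OF _ x]) (intro tendsto_intros filterlim_ident)
  then have "eventually (\<lambda>y. \<phi> y = 0) (nhds x)" by (rule eventually_mono) (rule \<phi>)
  then have "(\<phi> has_real_derivative 0) (at x)"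
    by (subst DERIV_cong_ev[OF refl _ refl, where g = "\<lambda>_. 0"]) auto
  then show ?thesis by (rule DERIV_imp_deriv)
qed

text \<open>
  The difference of two mollified values is the pairing of the weak derivative with the difference
  of the antiderivatives of the two kernels, which is bounded by \<open>1\<close> and supported near \<open>[a,b]\<close>.
\<close>

lemma H1_conv_diff_le:
  assumes u: "in_L2 u" and g: "in_L2 g" and wd: "is_weak_derivative u g"
    and k: "mollifier d k" "d \<le> \<delta>" and l: "mollifier e l" "e \<le> \<delta>"
  shows "\<bar>conv l u b - conv k u a\<bar> \<le> L2_norm g * sqrt (\<bar>b - a\<bar> + 2 * \<delta>)"
proof -
  note kD = mollifierD[OF k(1)] and lD = mollifierD[OF l(1)]
  obtain K where K: "\<And>x. (K has_real_derivative k x) (at x)" "\<And>x. x \<le> -d \<Longrightarrow> K x = 0"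
    "\<And>x. d \<le> x \<Longrightarrow> K x = 1" "\<And>x. 0 \<le> K x" "\<And>x. K x \<le> 1"
    using mollifier_antiderivative[OF k(1)] by blast
  obtain L where L: "\<And>x. (L has_real_derivative l x) (at x)" "\<And>x. x \<le> -e \<Longrightarrow> L x = 0"
    "\<And>x. e \<le> x \<Longrightarrow> L x = 1" "\<And>x. 0 \<le> L x" "\<And>x. L x \<le> 1"
    using mollifier_antiderivative[OF l(1)] by blast
  define \<phi> where "\<phi> y = L (b - y) - K (a - y)" for y
  define I where "I = {min a b - \<delta>..max a b + \<delta>}"
  have \<phi>': "(\<phi> has_real_derivative k (-1 * y + a) + (-1) * l (-1 * y + b)) (at y)" for y
    unfolding \<phi>_def
    by (rule DERIV_cong[OF DERIV_diff[OF DERIV_chain2[OF L(1)] DERIV_chain2[OF K(1)]]])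
       (auto intro!: derivative_eq_intros)
  have "class_C (Suc n) \<phi>" for n
    by (rule class_C_SucI[OF \<phi>'])
       (intro class_C_add class_C_mult class_C_const class_C_affine kD(1) lD(1))
  then have \<phi>C: "class_C n \<phi>" for n
    using class_C_Suc_imp by blast
  have supp: "\<phi> y = 0" if "y \<notin> I" for y
    using that K(2,3)[of "a - y"] L(2,3)[of "b - y"] k(2) l(2)
    by (cases "y < min a b - \<delta>") (auto simp: \<phi>_def I_def)
  have bd: "\<bar>\<phi> y\<bar> \<le> 1" for y
    using K(4,5)[of "a - y"] L(4,5)[of "b - y"] by (auto simp: \<phi>_def)
  have suppR: "\<phi> y = 0" if "\<bar>a\<bar> + \<bar>b\<bar> + \<bar>\<delta>\<bar> < \<bar>y\<bar>" for y
    by (rule supp) (use that in \<open>auto simp: I_def\<close>)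
  have test: "test_function \<phi>"
    unfolding test_function_def using \<phi>C suppR by blast
  have \<phi>L2: "in_L2 \<phi>"
    using in_L2_compact_support[OF class_C_imp_continuous[OF \<phi>C] suppR] by blast
  have "deriv \<phi> = (\<lambda>y. k (-1 * y + a) + (-1) * l (-1 * y + b))"
    using \<phi>' by (auto intro: DERIV_imp_deriv)
  then have "(LINT y|lborel. u y * deriv \<phi> y) = (LINT y|lborel. k (a - y) * u y - l (b - y) * u y)"
    by (simp add: algebra_simps)
  also have "\<dots> = conv k u a - conv l u b"
    unfolding conv_def
    by (intro Bochner_Integration.integral_diff in_L2_mult_integrable u
        mollifier_reflect_integrals(1)[OF k(1)] mollifier_reflect_integrals(1)[OF l(1)])
  finally have "conv l u b - conv k u a = (LINT y|lborel. g y * \<phi> y)"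
    using wd test by (simp add: is_weak_derivative_def)
  then have "\<bar>conv l u b - conv k u a\<bar> \<le> L2_norm g * L2_norm \<phi>"
    using L2_Cauchy_Schwarz[OF g \<phi>L2] by simp
  also have "L2_norm \<phi> \<le> sqrt (\<bar>b - a\<bar> + 2 * \<delta>)"
    unfolding L2_norm_def
  proof (rule real_sqrt_le_mono)
    have "(LINT y|lborel. (\<phi> y)\<^sup>2) \<le> (LINT y|lborel. indicator I y)"
    proof (rule integral_mono)
      show "integrable lborel (\<lambda>y. (\<phi> y)\<^sup>2)" using \<phi>L2 by (simp add: in_L2_def)
      show "integrable lborel (\<lambda>y. indicator I y :: real)" by (simp add: I_def emeasure_lborel_Icc_eq)
      show "(\<phi> y)\<^sup>2 \<le> indicator I y" for y
        using supp[of y] bd[of y] by (auto simp: indicator_def abs_square_le_1)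
    qed
    also have "\<dots> = \<bar>b - a\<bar> + 2 * \<delta>"
      using k(2) kD(6) by (auto simp: I_def min_def max_def)
    finally show "(LINT y|lborel. (\<phi> y)\<^sup>2) \<le> \<bar>b - a\<bar> + 2 * \<delta>" .
  qed
  finally show ?thesis by (simp add: mult_left_mono)
qed

text \<open>This identifies the limit of mollifications with \<open>u\<close> almost everywhere. By
  Fubini the integral of the convolution pairs \<open>u\<close> with K(b - y) - K(a - y), which
  differs from the indicator of [a,b] only within \<delta> of the two endpoints.\<close>

lemma integral_conv_approx:
  assumes k: "mollifier \<delta> k" and u: "in_L2 u" and ab: "a \<le> b"
  shows "\<bar>(LINT x:{a..b}|lborel. conv k u x) - (LINT x:{a..b}|lborel. u x)\<bar> \<le> L2_norm u * sqrt (16 * \<delta>)"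
proof -
  note kD = mollifierD[OF k] and kr = mollifier_reflect_integrals[OF k]
  obtain K where K: "\<And>x. (K has_real_derivative k x) (at x)" "\<And>x. x \<le> -\<delta> \<Longrightarrow> K x = 0"
    "\<And>x. \<delta> \<le> x \<Longrightarrow> K x = 1" "\<And>x. 0 \<le> K x" "\<And>x. K x \<le> 1"
    using mollifier_antiderivative[OF k] by blast
  have [measurable]: "k \<in> borel_measurable borel" "u \<in> borel_measurable borel"
    using kD(5) u by (auto simp: in_L2_def borel_measurable_continuous_onI)
  have "continuous_on UNIV K"
    using DERIV_isCont[OF K(1)] by (simp add: continuous_at_imp_continuous_on)
  then have [measurable]: "K \<in> borel_measurable borel" by (rule borel_measurable_continuous_onI)
  have au: "in_L2 (\<lambda>y. \<bar>u y\<bar>)" using u by (auto simp: in_L2_def)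
  let ?f = "\<lambda>x y. indicator {a..b} x * (k (x - y) * u y)"
  have "integrable (lborel \<Otimes>\<^sub>M lborel) (\<lambda>(x, y). ?f x y)"
  proof (rule lborel_pair.Fubini_integrable)
    have "(LINT y|lborel. norm (?f x y)) = indicator {a..b} x * conv k (\<lambda>y. \<bar>u y\<bar>) x" for x
      using kD(2) by (auto simp: conv_def abs_mult indicator_def)
    then show "integrable lborel (\<lambda>x. LINT y|lborel. norm (case (x, y) of (x, y) \<Rightarrow> ?f x y))"
      using in_L2_set_integrable[OF conv_L2(1)[OF k au], of a b] by (simp add: set_integrable_def)
    show "AE x in lborel. integrable lborel (\<lambda>y. case (x, y) of (x, y) \<Rightarrow> ?f x y)"
      using in_L2_mult_integrable[OF kr(1) u] by auto
  qed measurable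
  then have "(LINT x|lborel. LINT y|lborel. ?f x y) = (LINT y|lborel. LINT x|lborel. ?f x y)"
    by (rule lborel_pair.Fubini_integral[symmetric])
  moreover have "(LINT x|lborel. ?f x y) = (K (b - y) - K (a - y)) * u y" for y
  proof -
    have "((\<lambda>x. k (x - y)) has_integral K (b - y) - K (a - y)) {a..b}"
    proof (rule fundamental_theorem_of_calculus[OF ab])
      show "((\<lambda>x. K (x - y)) has_vector_derivative k (x - y)) (at x within {a..b})" for x
        unfolding has_real_derivative_iff_has_vector_derivative[symmetric]
        by (rule has_field_derivative_at_within)
           (rule DERIV_cong[OF DERIV_chain2[OF K(1)]], auto intro!: derivative_eq_intros)
    qed
    moreover have "set_integrable lborel {a..b} (\<lambda>x. k (x - y))"
      unfolding set_integrable_def by (intro integrable_mult_indicator kr(4)) auto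
    ultimately have "(LINT x:{a..b}|lborel. k (x - y)) = K (b - y) - K (a - y)"
      by (simp add: set_borel_integral_eq_integral(2) has_integral_iff)
    then show ?thesis
      by (simp add: set_lebesgue_integral_def mult.assoc[symmetric])
  qed
  ultimately have eq: "(LINT x:{a..b}|lborel. conv k u x) = (LINT y|lborel. (K (b - y) - K (a - y)) * u y)"
    by (simp add: set_lebesgue_integral_def conv_def)
  define D where "D y = K (b - y) - K (a - y) - indicator {a..b} y" for y
  \<comment> \<open>The factor 4 is the square of the bound |D| <= 2; two intervals of length 2
    \<delta> then give the mass 16 \<delta>.\<close>
  let ?J = "\<lambda>y. 4 * (indicator {a-\<delta>..a+\<delta>} y + indicator {b-\<delta>..b+\<delta>} y) :: real"
  have Jint: "integrable lborel ?J" by (simp add: emeasure_lborel_Icc_eq)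
  have DJ: "(D y)\<^sup>2 \<le> ?J y" for y
  proof (cases "y \<in> {a-\<delta>..a+\<delta>} \<union> {b-\<delta>..b+\<delta>}")
    case True
    have "\<bar>D y\<bar> \<le> 2"
      using K(4,5)[of "a - y"] K(4,5)[of "b - y"] by (auto simp: D_def indicator_def)
    then have "(D y)\<^sup>2 \<le> 2\<^sup>2" using abs_le_square_iff[of "D y" 2] by simp
    also have "\<dots> \<le> ?J y" using True by (auto simp: indicator_def)
    finally show ?thesis .
  next
    case False
    then have "D y = 0"
      using K(2,3)[of "a - y"] K(2,3)[of "b - y"] kD(6) ab
      by (cases "y < a - \<delta>"; cases "y > b + \<delta>") (auto simp: D_def indicator_def)
    then show ?thesis by (simp add: indicator_def)
  qed
  have DL2: "in_L2 D"
    unfolding in_L2_def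
  proof
    show m: "D \<in> borel_measurable borel" unfolding D_def by measurable
    show "integrable lborel (\<lambda>x. (D x)\<^sup>2)"
      by (rule Bochner_Integration.integrable_bound[OF Jint])
         (use m DJ in \<open>auto intro!: AE_I2 order_trans[OF DJ]\<close>)
  qed
  have "(LINT y|lborel. D y * u y) = (LINT y|lborel. (K (b - y) - K (a - y)) * u y) - (LINT x:{a..b}|lborel. u x)"
  proof -
    have "(LINT y|lborel. D y * u y) + (LINT y|lborel. indicator {a..b} y * u y)
        = (LINT y|lborel. D y * u y + indicator {a..b} y * u y)"
      by (intro Bochner_Integration.integral_add[symmetric] in_L2_mult_integrable DL2 u in_L2_indicator)
    also have "\<dots> = (LINT y|lborel. (K (b - y) - K (a - y)) * u y)"
      by (rule arg_cong) (auto simp: D_def algebra_simps)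
    finally show ?thesis by (simp add: set_lebesgue_integral_def)
  qed
  then have "\<bar>(LINT x:{a..b}|lborel. conv k u x) - (LINT x:{a..b}|lborel. u x)\<bar> \<le> L2_norm D * L2_norm u"
    using L2_Cauchy_Schwarz[OF DL2 u] eq by simp
  also have "L2_norm D \<le> sqrt (16 * \<delta>)"
    unfolding L2_norm_def
  proof (rule real_sqrt_le_mono)
    have "(LINT y|lborel. (D y)\<^sup>2) \<le> (LINT y|lborel. ?J y)"
      using DL2 DJ Jint by (intro integral_mono) (auto simp: in_L2_def)
    also have "\<dots> = 16 * \<delta>" using kD(6) by (simp add: emeasure_lborel_Icc_eq)
    finally show "(LINT y|lborel. (D y)\<^sup>2) \<le> 16 * \<delta>" .
  qed
  finally show ?thesis by (simp add: mult_right_mono mult.commute)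
qed

lemma L2_norm_cong_AE:
  assumes "u \<in> borel_measurable borel" "v \<in> borel_measurable borel" "AE x in lborel. u x = v x"
  shows "L2_norm u = L2_norm v"
  unfolding L2_norm_def by (intro arg_cong[of _ _ sqrt] integral_cong_AE) (use assms in auto)

text \<open>Mollifications at scales 1/(n+1) are uniformly Cauchy by \<open>H1_conv_diff_le\<close>,
  and their limit \<open>V\<close> inherits the Hoelder bound. The last conclusion, with a rate
  valid for every kernel, is what later makes mollification errors uniform in time.\<close>

lemma H1_representative:
  assumes u: "in_L2 u" and g: "in_L2 g" and wd: "is_weak_derivative u g"
  obtains V where "continuous_on UNIV V" "AE x in lborel. u x = V x"
    "\<And>a b. \<bar>V b - V a\<bar> \<le> L2_norm g * sqrt \<bar>b - a\<bar>"
    "\<And>x. \<bar>V x\<bar> \<le> L2_norm u + L2_norm g"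
    "\<And>\<delta> k x. mollifier \<delta> k \<Longrightarrow> \<bar>conv k u x - V x\<bar> \<le> L2_norm g * sqrt (2 * \<delta>)"
proof -
  define G where "G = L2_norm g"
  have "G \<ge> 0" by (simp add: G_def)
  have "\<exists>k. mollifier (1 / real (Suc n)) k" for n
    using mollifier_exists[of "1 / real (Suc n)"] by auto
  then obtain k where k: "\<And>n. mollifier (1 / real (Suc n)) (k n)" by metis
  define v where "v n = conv (k n) u" for n
  have lim0: "(\<lambda>n. 1 / real (Suc n)) \<longlonglongrightarrow> 0"
    by (rule LIMSEQ_Suc[OF lim_1_over_n])
  \<comment> \<open>Indices from N on use kernels of radius at most 1/(N+1), so the bound depends on
    N alone.\<close>
  have diff: "\<bar>v n b - v m a\<bar> \<le> G * sqrt (\<bar>b - a\<bar> + 2 * (1 / real (Suc N)))" if "n \<ge> N" "m \<ge> N" for n m N a b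
    unfolding v_def G_def
    by (rule H1_conv_diff_le[OF u g wd k _ k]) (use that in \<open>auto simp: field_simps\<close>)
  have sq0: "(\<lambda>n. G * sqrt (2 * (1 / real (Suc n)))) \<longlonglongrightarrow> 0"
    by (rule tendsto_eq_intros lim0 refl)+ simp
  have "Cauchy (\<lambda>n. v n x)" for x
  proof (rule metric_CauchyI)
    fix e :: real assume "e > 0"
    from order_tendstoD(2)[OF sq0 this]
    obtain N where "G * sqrt (2 * (1 / real (Suc N))) < e"
      unfolding eventually_sequentially by blast
    then have "\<forall>m\<ge>N. \<forall>n\<ge>N. dist (v m x) (v n x) < e"
      using diff[of N _ _ x x] by (force simp: dist_real_def)
    then show "\<exists>M. \<forall>m\<ge>M. \<forall>n\<ge>M. dist (v m x) (v n x) < e" by blast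
  qed
  then obtain V where V: "\<And>x. (\<lambda>n. v n x) \<longlonglongrightarrow> V x"
    unfolding Cauchy_convergent_iff convergent_def by metis
  have approx: "\<bar>conv l u x - V x\<bar> \<le> G * sqrt (2 * \<delta>)" if l: "mollifier \<delta> l" for l \<delta> x
  proof (rule tendsto_upperbound)
    show "(\<lambda>n. \<bar>conv l u x - v n x\<bar>) \<longlonglongrightarrow> \<bar>conv l u x - V x\<bar>"
      by (intro tendsto_intros V)
    have "eventually (\<lambda>n. 1 / real (Suc n) < \<delta>) sequentially"
      using order_tendstoD(2)[OF lim0] mollifierD(6)[OF l] by blast
    then show "eventually (\<lambda>n. \<bar>conv l u x - v n x\<bar> \<le> G * sqrt (2 * \<delta>)) sequentially"
    proof eventually_elim
      fix n assume "1 / real (Suc n) < \<delta>"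
      then show "\<bar>conv l u x - v n x\<bar> \<le> G * sqrt (2 * \<delta>)"
        unfolding v_def G_def using H1_conv_diff_le[OF u g wd k _ l, of n \<delta> x x] by simp
    qed
  qed simp
  have holder: "\<bar>V b - V a\<bar> \<le> G * sqrt \<bar>b - a\<bar>" for a b
  proof (rule LIMSEQ_le)
    show "(\<lambda>n. \<bar>v n b - v n a\<bar>) \<longlonglongrightarrow> \<bar>V b - V a\<bar>"
      by (intro tendsto_intros V)
    show "(\<lambda>n. G * sqrt (\<bar>b - a\<bar> + 2 * (1 / real (Suc n)))) \<longlonglongrightarrow> G * sqrt \<bar>b - a\<bar>"
      by (rule tendsto_eq_intros lim0 refl)+ simp
    show "\<exists>N. \<forall>n\<ge>N. \<bar>v n b - v n a\<bar> \<le> G * sqrt (\<bar>b - a\<bar> + 2 * (1 / real (Suc n)))"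
      using diff by blast
  qed
  have cont: "continuous_on UNIV V"
    unfolding continuous_on_def
  proof
    fix a :: real
    have "((\<lambda>b. G * sqrt \<bar>b - a\<bar>) \<longlongrightarrow> G * sqrt \<bar>a - a\<bar>) (at a)"
      by (intro tendsto_intros)
    then have "((\<lambda>b. G * sqrt \<bar>b - a\<bar>) \<longlongrightarrow> 0) (at a)" by simp
    then have "((\<lambda>b. V b - V a) \<longlongrightarrow> 0) (at a)"
      by (rule Lim_null_comparison[rotated]) (use holder in auto)
    then show "(V \<longlongrightarrow> V a) (at a within UNIV)" using LIM_zero_cancel[of V "V a"] by simp
  qed
  have [measurable]: "V \<in> borel_measurable borel" "u \<in> borel_measurable borel"
    using cont u by (auto simp: in_L2_def borel_measurable_continuous_onI)
  have intV: "set_integrable lborel {a..b} V" for a b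
    by (rule borel_integrable_atLeastAtMost') (use cont in \<open>auto intro: continuous_on_subset\<close>)
  have intu: "set_integrable lborel {a..b} u" for a b
    by (rule in_L2_set_integrable[OF u])
  have "AE x in lborel. u x - V x = 0"
  proof (rule AE_zero_if_integral_zero_on_intervals)
    show "set_integrable lborel {a..b} (\<lambda>x. u x - V x)" for a b
      by (intro set_integral_diff intV intu)
    fix a b :: real assume ab: "a \<le> b"
    \<comment> \<open>\<open>E\<close> does not involve n, but is bounded by two errors that tend to
      0: from \<open>u\<close> to its mollification, and from there to \<open>V\<close>.\<close>
    define E where "E = \<bar>(LINT x:{a..b}|lborel. u x) - (LINT x:{a..b}|lborel. V x)\<bar>"
    have "E \<le> 0"
    proof (rule tendsto_lowerbound)
      have "(\<lambda>n. L2_norm u * sqrt (16 * (1 / real (Suc n))) + (b - a) * (G * sqrt (2 * (1 / real (Suc n))))) \<longlonglongrightarrow> L2_norm u * sqrt (16 * 0) + (b - a) * 0"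
        by (intro tendsto_intros lim0 sq0)
      then show "(\<lambda>n. L2_norm u * sqrt (16 * (1 / real (Suc n))) + (b - a) * (G * sqrt (2 * (1 / real (Suc n))))) \<longlonglongrightarrow> 0"
        by simp
      show "\<forall>\<^sub>F n in sequentially. E \<le> L2_norm u * sqrt (16 * (1 / real (Suc n))) + (b - a) * (G * sqrt (2 * (1 / real (Suc n))))"
      proof (rule always_eventually, rule allI)
        fix n
        let ?s = "G * sqrt (2 * (1 / real (Suc n)))"
        have intv: "set_integrable lborel {a..b} (v n)"
          unfolding v_def by (rule in_L2_set_integrable[OF conv_L2(1)[OF k u]])
        have "\<bar>(LINT x:{a..b}|lborel. v n x) - (LINT x:{a..b}|lborel. V x)\<bar> = \<bar>LINT x:{a..b}|lborel. v n x - V x\<bar>"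
          using set_integral_diff(2)[OF intv intV] by simp
        also have "\<dots> \<le> (LINT x:{a..b}|lborel. ?s)"
        proof -
          have *: "set_integrable lborel {a..b} (\<lambda>x. v n x - V x)" by (intro set_integral_diff intV intv)
          have "\<bar>LINT x:{a..b}|lborel. v n x - V x\<bar> \<le> (LINT x:{a..b}|lborel. \<bar>v n x - V x\<bar>)"
            using set_integral_norm_bound[OF *] by simp
          also have "\<dots> \<le> (LINT x:{a..b}|lborel. ?s)"
          proof (rule set_integral_mono)
            show "set_integrable lborel {a..b} (\<lambda>x. \<bar>v n x - V x\<bar>)"
              using set_integrable_abs[OF *] .
            show "set_integrable lborel {a..b} (\<lambda>x. ?s)"
              by (simp add: set_integrable_def emeasure_lborel_Icc_eq)
            show "\<bar>v n x - V x\<bar> \<le> ?s" for x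
              using approx[OF k] by (simp add: v_def)
          qed
          finally show ?thesis .
        qed
        also have "\<dots> = (b - a) * ?s"
          using ab by (simp add: set_lebesgue_integral_def)
        finally have 1: "\<bar>(LINT x:{a..b}|lborel. v n x) - (LINT x:{a..b}|lborel. V x)\<bar> \<le> (b - a) * ?s" .
        have 2: "\<bar>(LINT x:{a..b}|lborel. v n x) - (LINT x:{a..b}|lborel. u x)\<bar> \<le> L2_norm u * sqrt (16 * (1 / real (Suc n)))"
          unfolding v_def by (rule integral_conv_approx[OF k u ab])
        show "E \<le> L2_norm u * sqrt (16 * (1 / real (Suc n))) + (b - a) * ?s"
          using 1 2 unfolding E_def by linarith
      qed
    qed simp
    then show "(LINT x:{a..b}|lborel. u x - V x) = 0"
      using set_integral_diff(2)[OF intu intV] by (simp add: E_def)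
  qed
  then have ae: "AE x in lborel. u x = V x" by simp
  have bound: "\<bar>V x\<bar> \<le> L2_norm u + G" for x
  proof (rule ccontr)
    assume neg: "\<not> ?thesis"
    \<comment> \<open>The Hoelder bound costs at most G over a distance at most 1, so |V| >= c on
      [x, x+1] and hence c is at most the L^2 norm.\<close>
    define c where "c = \<bar>V x\<bar> - G"
    have c: "c > L2_norm u" using neg by (simp add: c_def)
    have VL2: "integrable lborel (\<lambda>y. (V y)\<^sup>2)"
    proof (rule integrable_cong_AE_imp)
      show "integrable lborel (\<lambda>x. (u x)\<^sup>2)" using u by (simp add: in_L2_def)
      show "AE x in lborel. (u x)\<^sup>2 = (V x)\<^sup>2" using ae by eventually_elim simp
    qed auto
    have "c\<^sup>2 = (LINT y|lborel. indicator {x..x+1} y * c\<^sup>2)" by simp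
    also have "\<dots> \<le> (LINT y|lborel. (V y)\<^sup>2)"
    proof (rule integral_mono[OF _ VL2])
      show "integrable lborel (\<lambda>y. indicator {x..x+1} y * c\<^sup>2)" by (simp add: emeasure_lborel_Icc_eq)
      fix y
      show "indicator {x..x+1} y * c\<^sup>2 \<le> (V y)\<^sup>2"
      proof (cases "y \<in> {x..x+1}")
        case True
        have "\<bar>V x - V y\<bar> \<le> G * sqrt \<bar>x - y\<bar>" by (rule holder)
        also have "\<dots> \<le> G * 1"
          using True \<open>G \<ge> 0\<close> by (intro mult_left_mono) (auto simp: real_sqrt_le_1_iff)
        finally have "c \<le> \<bar>V y\<bar>" unfolding c_def by linarith
        moreover have "c \<ge> 0" using c L2_norm_nonneg[of u] by linarith
        ultimately show ?thesis using True by (simp add: abs_le_square_iff[symmetric])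
      qed simp
    qed
    also have "\<dots> = (L2_norm V)\<^sup>2" by (simp add: L2_norm_power2)
    also have "L2_norm V = L2_norm u"
      by (rule L2_norm_cong_AE) (use ae in auto)
    finally have "c \<le> L2_norm u" by (rule power2_le_imp_le) simp
    then show False using c by simp
  qed
  show thesis
    by (rule that[OF cont ae]) (use holder bound approx in \<open>auto simp: G_def\<close>)
qed

lemma weak_derivative_spec:
  assumes "in_H1 v"
  shows "in_L2 (weak_derivative v)" "is_weak_derivative v (weak_derivative v)"
proof -
  have "in_L2 (weak_derivative v) \<and> is_weak_derivative v (weak_derivative v)"
    using assms unfolding in_H1_def weak_derivative_def
    by (intro someI_ex[of "\<lambda>g. in_L2 g \<and> is_weak_derivative v g"]) simp
  then show "in_L2 (weak_derivative v)" "is_weak_derivative v (weak_derivative v)" by auto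
qed

lemma L2_norm_le_H1_norm: "L2_norm v \<le> H1_norm v" "L2_norm (weak_derivative v) \<le> H1_norm v"
  unfolding H1_norm_def by (auto intro: real_le_rsqrt)

text \<open>The weak derivative is tested with y |-> k(x - y). Thus the derivative of a
  mollification is the mollified weak derivative, and its L^2 norm is bounded independently of the
  kernel.\<close>

lemma conv_deriv_eq:
  assumes v: "in_H1 v" and k: "mollifier \<delta> k"
  shows "conv (deriv k) v x = conv k (weak_derivative v) x"
proof -
  note kD = mollifierD[OF k]
  define \<phi> where "\<phi> y = k (-1 * y + x)" for y
  have "class_C n \<phi>" for n unfolding \<phi>_def by (intro class_C_affine kD(1))
  moreover have "\<phi> y = 0" if "\<bar>x\<bar> + \<delta> < \<bar>y\<bar>" for y
    unfolding \<phi>_def by (rule kD(3)) (use that in auto)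
  ultimately have test: "test_function \<phi>" unfolding test_function_def by blast
  have "(\<phi> has_real_derivative - deriv k (x - y)) (at y)" for y
    unfolding \<phi>_def
    by (rule DERIV_cong[OF DERIV_chain2[OF class_C_Suc_DERIV[OF kD(1)]]])
       (auto intro!: derivative_eq_intros)
  then have "deriv \<phi> = (\<lambda>y. - deriv k (x - y))" by (auto intro: DERIV_imp_deriv)
  then show ?thesis
    using weak_derivative_spec(2)[OF v] test
    unfolding is_weak_derivative_def conv_def by (auto simp: \<phi>_def mult.commute)
qed

text \<open>Lets the sup bound of continuous representatives be applied to differences of two time
  slices. Only membership is claimed; \<open>H1_norm\<close> of the difference refers to its own
  chosen weak derivative.\<close>

lemma in_H1_diff:
  assumes u: "in_H1 u" and v: "in_H1 v"
  shows "in_H1 (\<lambda>x. u x - v x)"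
proof -
  have L2: "in_L2 (\<lambda>x. f x - h x)" if "in_L2 f" "in_L2 h" for f h
  proof -
    have "integrable lborel (\<lambda>x. (f x)\<^sup>2 - 2 * (f x * h x) + (h x)\<^sup>2)"
      using that in_L2_mult_integrable[OF that] by (auto simp: in_L2_def)
    moreover have "(\<lambda>x. (f x)\<^sup>2 - 2 * (f x * h x) + (h x)\<^sup>2) = (\<lambda>x. (f x - h x)\<^sup>2)"
      by (auto simp: power2_diff)
    ultimately show ?thesis using that by (auto simp: in_L2_def)
  qed
  have u2: "in_L2 u" and v2: "in_L2 v" using u v by (auto simp: in_H1_def)
  note gu = weak_derivative_spec[OF u] and gv = weak_derivative_spec[OF v]
  have "is_weak_derivative (\<lambda>x. u x - v x) (\<lambda>x. weak_derivative u x - weak_derivative v x)"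
    unfolding is_weak_derivative_def
  proof (intro allI impI)
    fix \<phi> assume t: "test_function \<phi>"
    then obtain R where R: "\<And>x. R < \<bar>x\<bar> \<Longrightarrow> \<phi> x = 0" and C: "\<And>n. class_C n \<phi>"
      unfolding test_function_def by blast
    have p: "in_L2 \<phi>"
      using in_L2_compact_support[OF class_C_imp_continuous[OF C] R] by blast
    have "continuous_on UNIV (deriv \<phi>)"
      using C[of "Suc 0"] by (simp add: class_C_Suc)
    then have p': "in_L2 (deriv \<phi>)"
      using deriv_eq_0_outside[OF R] by (rule in_L2_compact_support)
    have "(LINT x|lborel. (u x - v x) * deriv \<phi> x) = (LINT x|lborel. u x * deriv \<phi> x) - (LINT x|lborel. v x * deriv \<phi> x)"
      using in_L2_mult_integrable[OF u2 p'] in_L2_mult_integrable[OF v2 p'] by (simp add: left_diff_distrib)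
    also have "\<dots> = - (LINT x|lborel. weak_derivative u x * \<phi> x) + (LINT x|lborel. weak_derivative v x * \<phi> x)"
      using gu(2) gv(2) t by (simp add: is_weak_derivative_def)
    also have "\<dots> = - (LINT x|lborel. (weak_derivative u x - weak_derivative v x) * \<phi> x)"
      using in_L2_mult_integrable[OF gu(1) p] in_L2_mult_integrable[OF gv(1) p] by (simp add: left_diff_distrib)
    finally show "(LINT x|lborel. (u x - v x) * deriv \<phi> x) = - (LINT x|lborel. (weak_derivative u x - weak_derivative v x) * \<phi> x)" .
  qed
  then show ?thesis unfolding in_H1_def using L2 u2 v2 gu(1) gv(1) by blast
qed

lemma H1_continuous_representative:
  assumes "in_H1 v"
  obtains V where "continuous_on UNIV V" "AE x in lborel. v x = V x"
    "\<And>a b. \<bar>V b - V a\<bar> \<le> H1_norm v * sqrt \<bar>b - a\<bar>" "\<And>x. \<bar>V x\<bar> \<le> 2 * H1_norm v"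
    "\<And>\<delta> k x. mollifier \<delta> k \<Longrightarrow> \<bar>conv k v x - V x\<bar> \<le> H1_norm v * sqrt (2 * \<delta>)"
proof -
  have v: "in_L2 v" using assms by (simp add: in_H1_def)
  note wd = weak_derivative_spec[OF assms] and le = L2_norm_le_H1_norm[of v]
  obtain V where V: "continuous_on UNIV V" "AE x in lborel. v x = V x"
    "\<And>a b. \<bar>V b - V a\<bar> \<le> L2_norm (weak_derivative v) * sqrt \<bar>b - a\<bar>"
    "\<And>x. \<bar>V x\<bar> \<le> L2_norm v + L2_norm (weak_derivative v)"
    "\<And>\<delta> k x. mollifier \<delta> k \<Longrightarrow> \<bar>conv k v x - V x\<bar> \<le> L2_norm (weak_derivative v) * sqrt (2 * \<delta>)"
    using H1_representative[OF v wd] by blast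
  have G: "L2_norm (weak_derivative v) * s \<le> H1_norm v * s" if "s \<ge> 0" for s
    using le that by (intro mult_right_mono)
  show thesis
  proof (rule that[OF V(1,2)])
    show "\<bar>V b - V a\<bar> \<le> H1_norm v * sqrt \<bar>b - a\<bar>" for a b
      using V(3)[of b a] G[of "sqrt \<bar>b - a\<bar>"] by simp
    show "\<bar>V x\<bar> \<le> 2 * H1_norm v" for x
      using V(4)[of x] le by simp
    show "\<bar>conv k v x - V x\<bar> \<le> H1_norm v * sqrt (2 * \<delta>)" if "mollifier \<delta> k" for \<delta> k x
      using V(5)[OF that, of x] G[of "sqrt (2 * \<delta>)"] mollifierD(6)[OF that]
      by (meson less_imp_le mult_nonneg_nonneg order_trans real_sqrt_ge_zero zero_le_numeral)
  qed
qed

section \<open>Mollified solutions and the virial identity\<close>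

text \<open>After the substitution z = x - y, x sits in \<open>h\<close> alone and the domain is a
  fixed compact interval. This suits continuity in parameters, whereas differentiation in x keeps x
  in the kernel.\<close>

lemma conv_eq_integral:
  assumes l: "continuous_on UNIV l" "\<And>z. \<delta> < \<bar>z\<bar> \<Longrightarrow> l z = 0" and h: "continuous_on UNIV h"
  shows "conv l h x = integral {-\<delta>..\<delta>} (\<lambda>z. l z * h (x - z))"
proof -
  have "continuous_on UNIV (\<lambda>z. l z * h (x - z))"
    by (intro continuous_intros l continuous_on_compose2[OF h]) auto
  moreover have "l z * h (x - z) = 0" if "z \<notin> {-\<delta>..\<delta>}" for z
    using that l(2)[of z] by (auto simp: abs_if split: if_splits)
  ultimately have "(LINT z|lborel. l z * h (x - z)) = integral {-\<delta>..\<delta>} (\<lambda>z. l z * h (x - z))"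
    by (rule integrable_compact_support_Icc(2))
  moreover have "(LINT z|lborel. l z * h (x - z)) = conv l h x"
    using lborel_integral_real_affine[of "-1" "\<lambda>z. l z * h (x - z)" x] by (simp add: conv_def)
  ultimately show ?thesis by simp
qed

lemma continuous_on_conv:
  fixes H :: "real \<Rightarrow> real \<Rightarrow> real"
  assumes l: "continuous_on UNIV l" "\<And>z. \<delta> < \<bar>z\<bar> \<Longrightarrow> l z = 0"
    and H: "continuous_on UNIV (\<lambda>p. H (fst p) (snd p))"
  shows "continuous_on UNIV (\<lambda>p. conv l (H (fst p)) (snd p))"
proof -
  have Ht: "continuous_on UNIV (H t)" for t
  proof -
    have "continuous_on UNIV (\<lambda>x. (t, x))" by (intro continuous_intros)
    from continuous_on_compose2[OF H this] show ?thesis by simp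
  qed
  have "continuous_on (UNIV \<times> cbox (-\<delta>) \<delta>)
      (\<lambda>(p, z). l z * H (fst p) (snd p - z))"
    unfolding split_beta
    by (intro continuous_intros continuous_on_compose2[OF l(1)]
        continuous_on_compose2[OF H, where f = "\<lambda>w. (fst (fst w), snd (fst w) - snd w)", simplified]) auto
  from integral_continuous_on_param[OF this] show ?thesis
    by (simp add: conv_eq_integral[OF l Ht])
qed

lemma conv_DERIV:
  assumes l: "\<And>x. (l has_real_derivative l' x) (at x)" "continuous_on UNIV l'"
    and supp: "\<And>z. \<delta> < \<bar>z\<bar> \<Longrightarrow> l z = 0" "\<And>z. \<delta> < \<bar>z\<bar> \<Longrightarrow> l' z = 0"
    and h: "continuous_on UNIV h"
  shows "(conv l h has_real_derivative conv l' h x) (at x)"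
proof -
  \<comment> \<open>One interval containing the support of z |-> l(y - z) for all y within distance
    1 of x, so that the Leibniz rule applies on a fixed domain.\<close>
  define a b where "a = x - \<bar>\<delta>\<bar> - 1" and "b = x + \<bar>\<delta>\<bar> + 1"
  have lc: "continuous_on UNIV l"
    using DERIV_isCont[OF l(1)] by (simp add: continuous_at_imp_continuous_on)
  have eq: "conv m h y = integral (cbox a b) (\<lambda>z. m (y - z) * h z)"
    if "continuous_on UNIV m" "\<And>z. \<delta> < \<bar>z\<bar> \<Longrightarrow> m z = 0" "\<bar>y - x\<bar> < 1" for m y
  proof -
    have "continuous_on UNIV (\<lambda>z. m (y - z) * h z)"
      by (intro continuous_intros h continuous_on_compose2[OF that(1)]) auto
    moreover have "m (y - z) * h z = 0" if "z \<notin> {a..b}" for z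
    proof -
      have "\<delta> < \<bar>y - z\<bar>" using that \<open>\<bar>y - x\<bar> < 1\<close> by (auto simp: a_def b_def)
      then show ?thesis using \<open>\<And>z. \<delta> < \<bar>z\<bar> \<Longrightarrow> m z = 0\<close> by simp
    qed
    ultimately show ?thesis
      unfolding conv_def cbox_interval by (rule integrable_compact_support_Icc(2))
  qed
  have "((\<lambda>y. integral (cbox a b) (\<lambda>z. l (y - z) * h z)) has_real_derivative
      integral (cbox a b) (\<lambda>z. l' (x - z) * h z)) (at x within UNIV)"
  proof (rule leibniz_rule_field_derivative)
    fix y z :: real
    show "((\<lambda>y. l (y - z) * h z) has_real_derivative l' (y - z) * h z) (at y within UNIV)"
      by (rule DERIV_cmult_right) (rule DERIV_cong[OF DERIV_chain2[OF l(1)]], auto intro!: derivative_eq_intros)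
    show "(\<lambda>z. l (y - z) * h z) integrable_on cbox a b"
      by (intro integrable_continuous continuous_intros continuous_on_compose2[OF lc] continuous_on_compose2[OF h]) auto
  next
    show "continuous_on (UNIV \<times> cbox a b) (\<lambda>(y, z). l' (y - z) * h z)"
      unfolding split_beta
      by (intro continuous_intros continuous_on_compose2[OF l(2)] continuous_on_compose2[OF h]) auto
  qed auto
  moreover have "eventually (\<lambda>y. \<bar>y - x\<bar> < 1) (nhds x)"
    using eventually_nhds_metric[of "\<lambda>y. \<bar>y - x\<bar> < 1" x] by (auto simp: dist_real_def intro!: exI[of _ 1])
  then have "eventually (\<lambda>y. conv l h y = integral (cbox a b) (\<lambda>z. l (y - z) * h z)) (nhds x)"
    by eventually_elim (rule eq[OF lc supp(1)])
  ultimately show ?thesis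
    using eq[OF l(2) supp(2), of x] by (subst DERIV_cong_ev[OF refl _ refl]) auto
qed

lemma mollifier_higher_deriv:
  assumes k: "mollifier \<delta> k"
  shows "class_C m ((deriv ^^ n) k)" "\<delta> < \<bar>x\<bar> \<Longrightarrow> (deriv ^^ n) k x = 0"
    "continuous_on UNIV ((deriv ^^ n) k)"
    "((deriv ^^ n) k has_real_derivative (deriv ^^ Suc n) k x) (at x)"
proof -
  have C: "class_C m ((deriv ^^ n) k)" for m n
  proof (induction n arbitrary: m)
    case 0 then show ?case using mollifierD(1)[OF k] by simp
  next
    case (Suc n) then show ?case using class_C_Suc[of m "(deriv ^^ n) k"] by simp
  qed
  then show "class_C m ((deriv ^^ n) k)" .
  show "continuous_on UNIV ((deriv ^^ n) k)" using class_C_imp_continuous[OF C] .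
  show "((deriv ^^ n) k has_real_derivative (deriv ^^ Suc n) k x) (at x)"
    using class_C_Suc_DERIV[OF C] by simp
  show "\<delta> < \<bar>x\<bar> \<Longrightarrow> (deriv ^^ n) k x = 0"
  proof (induction n arbitrary: x)
    case 0 then show ?case using mollifierD(3)[OF k, of x] by simp
  next
    case (Suc n) then show ?case using deriv_eq_0_outside[of \<delta> "(deriv ^^ n) k"] by simp
  qed
qed

lemma conv_cong_AE:
  assumes "mollifier \<delta> k" "u \<in> borel_measurable borel" "v \<in> borel_measurable borel"
    "AE x in lborel. u x = v x"
  shows "conv ((deriv ^^ n) k) u x = conv ((deriv ^^ n) k) v x"
proof -
  have [measurable]: "(deriv ^^ n) k \<in> borel_measurable borel"
    using mollifier_higher_deriv(3)[OF assms(1)] by (rule borel_measurable_continuous_onI)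
  show ?thesis
    unfolding conv_def by (rule integral_cong_AE) (use assms in auto)
qed

text \<open>Testing the weak equation with y |-> k(x - y) makes it a classical evolution equation in
  t for each fixed x. Each y-derivative of the reflected kernel brings a factor -1, and the orders 3
  and 1 are both odd, whence the common minus sign.\<close>

lemma solves_gKdV_conv_DERIV:
  assumes k: "mollifier \<delta> k" and sol: "solves_gKdV f u" and f: "continuous_on UNIV f"
    and u: "\<And>t. u t \<in> borel_measurable borel" "\<And>t. AE x in lborel. u t x = U t x"
    and U: "\<And>t. continuous_on UNIV (U t)"
  shows "((\<lambda>s. conv k (U s) x) has_real_derivative
     - (conv ((deriv ^^ 3) k) (U t) x + conv (deriv k) (\<lambda>y. f (U t y)) x)) (at t)"
proof -
  note kD = mollifierD[OF k] and kn = mollifier_higher_deriv[OF k]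
  have Um[measurable]: "U t \<in> borel_measurable borel" for t
    using U by (rule borel_measurable_continuous_onI)
  note [measurable] = u(1) borel_measurable_continuous_onI[OF f]
  define \<phi> where "\<phi> n y = (-1) ^ n * (deriv ^^ n) k (-1 * y + x)" for n y
  have \<phi>': "(\<phi> n has_real_derivative \<phi> (Suc n) y) (at y)" for n y
    unfolding \<phi>_def
    by (rule DERIV_cong[OF DERIV_cmult[OF DERIV_chain2[OF kn(4)]]])
       (auto intro!: derivative_eq_intros)
  then have d: "deriv (\<phi> n) = \<phi> (Suc n)" for n by (auto intro: DERIV_imp_deriv)
  then have dn: "(deriv ^^ n) (\<phi> 0) = \<phi> n" for n by (induction n) auto
  have \<phi>C: "class_C m (\<phi> n)" for m n
    unfolding \<phi>_def by (intro class_C_mult class_C_const class_C_affine kn(1))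
  have \<phi>supp: "\<phi> n y = 0" if "y \<notin> {x - \<delta>..x + \<delta>}" for n y
  proof -
    have "\<delta> < \<bar>- y + x\<bar>" using that by auto
    then show ?thesis using kn(2) by (simp add: \<phi>_def)
  qed
  have "\<phi> 0 y = 0" if "\<bar>x\<bar> + \<delta> < \<bar>y\<bar>" for y
    by (rule \<phi>supp) (use that in auto)
  then have "test_function (\<phi> 0)"
    unfolding test_function_def using \<phi>C by blast
  then have D: "((\<lambda>s. LINT y|lborel. u s y * \<phi> 0 y) has_real_derivative
     (LINT y|lborel. u t y * \<phi> 3 y + f (u t y) * \<phi> 1 y)) (at t)"
    using sol[unfolded solves_gKdV_def, rule_format, of "\<phi> 0" t] dn[of 3] dn[of 1] by simp
  have \<phi>m[measurable]: "\<phi> n \<in> borel_measurable borel" for n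
    using class_C_imp_continuous[OF \<phi>C] by (rule borel_measurable_continuous_onI)
  have "(LINT y|lborel. u s y * \<phi> 0 y) = conv k (U s) x" for s
  proof -
    have "(LINT y|lborel. u s y * \<phi> 0 y) = (LINT y|lborel. U s y * \<phi> 0 y)"
      by (rule integral_cong_AE) (use u(2)[of s] in auto)
    then show ?thesis by (simp add: conv_def \<phi>_def mult.commute)
  qed
  moreover have "(LINT y|lborel. u t y * \<phi> 3 y + f (u t y) * \<phi> 1 y) =
     - (conv ((deriv ^^ 3) k) (U t) x + conv (deriv k) (\<lambda>y. f (U t y)) x)"
  proof -
    have fU: "continuous_on UNIV (\<lambda>y. f (U t y))"
      by (rule continuous_on_compose2[OF f U]) auto
    have "integrable lborel (\<lambda>y. h y * \<phi> n y)" if "continuous_on UNIV h" for h n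
      by (rule integrable_compact_support_Icc(1)[of _ "x - \<delta>" "x + \<delta>"])
         (auto intro!: continuous_intros that class_C_imp_continuous[OF \<phi>C] simp: \<phi>supp)
    note i = this[OF U] this[OF fU]
    have "(LINT y|lborel. u t y * \<phi> 3 y + f (u t y) * \<phi> 1 y) =
      (LINT y|lborel. U t y * \<phi> 3 y + f (U t y) * \<phi> 1 y)"
      by (rule integral_cong_AE) (use u(2)[of t] in \<open>auto elim!: eventually_mono\<close>)
    also have "\<dots> = (LINT y|lborel. U t y * \<phi> 3 y) + (LINT y|lborel. f (U t y) * \<phi> 1 y)"
      using i by (rule Bochner_Integration.integral_add)
    also have "\<dots> = - (conv ((deriv ^^ 3) k) (U t) x + conv (deriv k) (\<lambda>y. f (U t y)) x)"
      by (simp add: conv_def \<phi>_def mult.commute)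
    finally show ?thesis .
  qed
  ultimately show ?thesis using D by simp
qed

text \<open>Integration by parts in local form, with explicit flux. \<open>q\<close> stands for the
  mollified nonlinearity, so q_x cannot be replaced by f(v)_x: -(pv)_x q is split into -(pv)_x (q -
  f(v)), kept as an error, and -(pv)_x f(v), which equals -(p F(v))_x - p_x (v f(v) - F(v)).\<close>

lemma energy_density_DERIV:
  fixes v v1 v2 v3 q q1 p p1 p2 p3 f F :: "real \<Rightarrow> real"
  assumes v: "\<And>x. (v has_real_derivative v1 x) (at x)" "\<And>x. (v1 has_real_derivative v2 x) (at x)"
      "\<And>x. (v2 has_real_derivative v3 x) (at x)"
    and q: "\<And>x. (q has_real_derivative q1 x) (at x)"
    and p: "\<And>x. (p has_real_derivative p1 x) (at x)" "\<And>x. (p1 has_real_derivative p2 x) (at x)"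
      "\<And>x. (p2 has_real_derivative p3 x) (at x)"
    and Fv: "\<And>x. ((\<lambda>x. F (v x)) has_real_derivative f (v x) * v1 x) (at x)"
  shows "((\<lambda>x. p x * (v x * v2 x) - 1/2 * (p x * (v1 x * v1 x)) - p1 x * (v x * v1 x)
      + 1/2 * (p2 x * (v x * v x)) + p x * (v x * q x) - p x * F (v x)) has_real_derivative
    p x * v x * (v3 x + q1 x) - (3/2 * p1 x * (v1 x)\<^sup>2 - 1/2 * p3 x * (v x)\<^sup>2
      - p1 x * (v x * f (v x) - F (v x)) - (p1 x * v x + p x * v1 x) * (q x - f (v x)))) (at x)"
proof -
  note M = DERIV_mult[of _ _ x UNIV]
  note m = M[OF p(1) M[OF v(1) v(3)]] M[OF p(1) M[OF v(2) v(2)]] M[OF p(2) M[OF v(1) v(2)]]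
    M[OF p(3) M[OF v(1) v(1)]] M[OF p(1) M[OF v(1) q(1)]] M[OF p(1) Fv]
  note D = DERIV_diff[OF DERIV_add[OF DERIV_add[OF DERIV_diff[OF DERIV_diff[OF m(1)
    DERIV_cmult[OF m(2), of "1/2"]] m(3)] DERIV_cmult[OF m(4), of "1/2"]] m(5)] m(6)]
  show ?thesis
    by (rule DERIV_cong[OF D]) (simp add: power2_eq_square ring_distribs)
qed

text \<open>Every term of the flux \<open>B\<close> carries a factor p, p' or p'', so nothing
  remains at the endpoints.\<close>

lemma energy_identity:
  fixes v v1 v2 v3 q q1 p p1 p2 p3 f F :: "real \<Rightarrow> real"
  assumes L: "0 \<le> L"
    and v: "\<And>x. (v has_real_derivative v1 x) (at x)" "\<And>x. (v1 has_real_derivative v2 x) (at x)"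
      "\<And>x. (v2 has_real_derivative v3 x) (at x)" "continuous_on UNIV v3"
    and q: "\<And>x. (q has_real_derivative q1 x) (at x)" "continuous_on UNIV q1"
    and p: "\<And>x. (p has_real_derivative p1 x) (at x)" "\<And>x. (p1 has_real_derivative p2 x) (at x)"
      "\<And>x. (p2 has_real_derivative p3 x) (at x)" "continuous_on UNIV p3"
    and F: "\<And>s. (F has_real_derivative f s) (at s)" "continuous_on UNIV f"
    and bdry: "p L = 0" "p (-L) = 0" "p1 L = 0" "p1 (-L) = 0" "p2 L = 0" "p2 (-L) = 0"
  shows "integral {-L..L} (\<lambda>x. p x * v x * (v3 x + q1 x)) =
    integral {-L..L} (\<lambda>x. 3/2 * p1 x * (v1 x)\<^sup>2 - 1/2 * p3 x * (v x)\<^sup>2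
      - p1 x * (v x * f (v x) - F (v x)) - (p1 x * v x + p x * v1 x) * (q x - f (v x)))"
proof -
  define B where "B x = p x * (v x * v2 x) - 1/2 * (p x * (v1 x * v1 x)) - p1 x * (v x * v1 x) + 1/2 * (p2 x * (v x * v x))
      + p x * (v x * q x) - p x * F (v x)" for x
  define l where "l x = p x * v x * (v3 x + q1 x)" for x
  define r where "r x = 3/2 * p1 x * (v1 x)\<^sup>2 - 1/2 * p3 x * (v x)\<^sup>2
      - p1 x * (v x * f (v x) - F (v x)) - (p1 x * v x + p x * v1 x) * (q x - f (v x))" for x
  have Fv: "((\<lambda>x. F (v x)) has_real_derivative f (v x) * v1 x) (at x)" for x
    by (rule DERIV_chain2[OF F(1) v(1)])
  have B': "(B has_real_derivative l x - r x) (at x)" for x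
    unfolding B_def l_def r_def by (rule energy_density_DERIV[OF v(1-3) q(1) p(1-3) Fv])
  have cont: "continuous_on UNIV g" if "\<And>x. (g has_real_derivative g' x) (at x)" for g g' :: "real \<Rightarrow> real"
    using DERIV_isCont[OF that] by (simp add: continuous_at_imp_continuous_on)
  note c = cont[OF v(1)] cont[OF v(2)] v(4) cont[OF q(1)] q(2) cont[OF p(1)] cont[OF p(2)] p(4)
  have lc: "continuous_on {-L..L} l" unfolding l_def
    by (rule continuous_on_subset[of UNIV]) (auto intro!: continuous_intros c)
  have fc: "continuous_on UNIV (\<lambda>x. f (v x))" "continuous_on UNIV (\<lambda>x. F (v x))"
    by (intro continuous_on_compose2[OF F(2) c(1)] continuous_on_compose2[OF cont[OF F(1)] c(1)], simp)+
  have rc: "continuous_on {-L..L} r" unfolding r_def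
    by (rule continuous_on_subset[of UNIV], intro continuous_intros c fc) simp
  have "((\<lambda>x. l x - r x) has_integral B L - B (-L)) {-L..L}"
    by (rule fundamental_theorem_of_calculus)
       (use L B' in \<open>auto simp: has_real_derivative_iff_has_vector_derivative[symmetric] intro: has_field_derivative_at_within\<close>)
  then have "integral {-L..L} (\<lambda>x. l x - r x) = 0"
    using bdry by (simp add: B_def has_integral_iff)
  then have "integral {-L..L} l = integral {-L..L} r"
    using lc rc by (subst (asm) Henstock_Kurzweil_Integration.integral_diff) (auto intro: integrable_continuous_real)
  then show ?thesis by (simp add: l_def[abs_def] r_def[abs_def])
qed

text \<open>Optimizing in c: the choice c = sqrt(D/a) gives X <= A + 2 sqrt(a D), which is then
  squared with (x + y)^2 <= 2 x^2 + 2 y^2. For D = 0 the optimum is not attained and c tends to 0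
  instead.\<close>

lemma le_of_le_add_mult_add_divide:
  fixes X A a D :: real
  assumes le: "\<And>c. 0 < c \<Longrightarrow> X \<le> A + c * a + D / c" and "0 < a" "0 \<le> D" "0 \<le> X" "0 \<le> A"
  shows "X\<^sup>2 \<le> 2 * A\<^sup>2 + 8 * a * D"
proof -
  have "X \<le> A + 2 * sqrt (a * D)"
  proof (cases "D = 0")
    case True
    have "X \<le> A + e" if "e > 0" for e
      using le[of "e / a"] True \<open>0 < a\<close> that by simp
    then show ?thesis using True by (auto intro: field_le_epsilon)
  next
    case False
    define s where "s = sqrt (a * D)"
    have s: "s > 0" "s * s = a * D" using False assms by (auto simp: s_def)
    have "X \<le> A + s / a * a + D / (s / a)" using le[of "s / a"] s \<open>0 < a\<close> by simp
    also have "D / (s / a) = s" using s \<open>0 < a\<close> by (simp add: field_simps)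
    also have "s / a * a = s" using \<open>0 < a\<close> by simp
    finally show ?thesis by (simp add: s_def)
  qed
  then have "X\<^sup>2 \<le> (A + 2 * sqrt (a * D))\<^sup>2" using assms by (intro power_mono)
  also have "\<dots> \<le> 2 * A\<^sup>2 + 2 * (2 * sqrt (a * D))\<^sup>2"
    using sum_squares_bound[of A "2 * sqrt (a * D)"] by (simp add: power2_sum)
  also have "\<dots> = 2 * A\<^sup>2 + 8 * a * D" using assms by (simp add: power_mult_distrib)
  finally show ?thesis .
qed

text \<open>
  A localized Gagliardo--Nirenberg inequality: multiplied by \<open>v\<^sup>2\<close> and integrated, it bounds
  \<open>\<integral>\<zeta>\<^sup>2v\<^sup>6\<close>, the nonlinear term of the virial identity, by a small multiple of \<open>\<integral>\<zeta>\<^sup>2v\<^sub>x\<^sup>2\<close>.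
\<close>

lemma localized_sup_bound:
  fixes v v1 \<zeta> \<zeta>1 :: "real \<Rightarrow> real"
  assumes v: "\<And>x. (v has_real_derivative v1 x) (at x)" "continuous_on UNIV v1"
    and \<zeta>: "\<And>x. (\<zeta> has_real_derivative \<zeta>1 x) (at x)" "continuous_on UNIV \<zeta>1"
      "\<And>x. \<bar>\<zeta>1 x\<bar> \<le> \<kappa>" "\<zeta> (-L) = 0" "\<And>x. 0 \<le> \<zeta> x"
    and a: "integral {-L..L} (\<lambda>x. (v x)\<^sup>2) \<le> a" "0 < a" and x: "x \<in> {-L..L}" and \<kappa>: "0 \<le> \<kappa>"
  shows "(\<zeta> x * (v x)\<^sup>2)\<^sup>2 \<le> 2 * (\<kappa> * a)\<^sup>2 + 8 * a * integral {-L..L} (\<lambda>x. (\<zeta> x)\<^sup>2 * (v1 x)\<^sup>2)"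
proof (rule le_of_le_add_mult_add_divide)
  have cont: "continuous_on UNIV g" if "\<And>x. (g has_real_derivative g' x) (at x)" for g g' :: "real \<Rightarrow> real"
    using DERIV_isCont[OF that] by (simp add: continuous_at_imp_continuous_on)
  note c = cont[OF v(1)] v(2) cont[OF \<zeta>(1)] \<zeta>(2)
  have int: "g integrable_on {-L..y}" if "continuous_on UNIV g" for g :: "real \<Rightarrow> real" and y
    by (rule integrable_continuous_real[OF continuous_on_subset[OF that]]) simp
  let ?D = "integral {-L..L} (\<lambda>x. (\<zeta> x)\<^sup>2 * (v1 x)\<^sup>2)"
  show "0 \<le> ?D"
    by (intro Henstock_Kurzweil_Integration.integral_nonneg int continuous_intros c) auto
  show "0 < a" "0 \<le> \<zeta> x * (v x)\<^sup>2" "0 \<le> \<kappa> * a"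
    using a \<zeta>(5) \<kappa> by auto
  fix l :: real assume l: "l > 0"
  \<comment> \<open>\<open>g\<close> is the derivative of \<zeta> v^2, integrated from -L, where
    \<zeta> vanishes. \<open>h\<close> dominates it by Young's inequality with free weight l, which
    the preceding optimization lemma eliminates.\<close>
  define g where "g y = \<zeta>1 y * (v y)\<^sup>2 + 2 * \<zeta> y * v y * v1 y" for y
  define h where "h y = (\<kappa> + l) * (v y)\<^sup>2 + ((\<zeta> y)\<^sup>2 * (v1 y)\<^sup>2) / l" for y
  have gc: "continuous_on UNIV g" and hc: "continuous_on UNIV h"
    unfolding g_def h_def using l by (intro continuous_intros c; simp)+
  have "((\<lambda>y. \<zeta> y * (v y)\<^sup>2) has_real_derivative g y) (at y)" for y
    unfolding g_def
    by (rule DERIV_cong, (rule derivative_intros v \<zeta>)+) (simp add: algebra_simps)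
  then have "(g has_integral \<zeta> x * (v x)\<^sup>2 - \<zeta> (-L) * (v (-L))\<^sup>2) {-L..x}"
    by (intro fundamental_theorem_of_calculus)
       (use x in \<open>auto simp: has_real_derivative_iff_has_vector_derivative[symmetric] intro: has_field_derivative_at_within\<close>)
  then have "\<zeta> x * (v x)\<^sup>2 = integral {-L..x} g" using \<zeta>(4) by (simp add: has_integral_iff)
  also have "\<dots> \<le> integral {-L..x} h"
  proof (rule integral_le[OF int[OF gc] int[OF hc]])
    fix y
    have "0 \<le> (l * v y - \<zeta> y * v1 y)\<^sup>2 / l" using l by simp
    also have "\<dots> = l * (v y)\<^sup>2 - 2 * \<zeta> y * v y * v1 y + ((\<zeta> y)\<^sup>2 * (v1 y)\<^sup>2) / l"
      using l by (simp add: power2_eq_square field_simps)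
    finally have "2 * \<zeta> y * v y * v1 y \<le> l * (v y)\<^sup>2 + ((\<zeta> y)\<^sup>2 * (v1 y)\<^sup>2) / l" by simp
    moreover have "\<zeta>1 y * (v y)\<^sup>2 \<le> \<kappa> * (v y)\<^sup>2"
      using \<zeta>(3)[of y] by (intro mult_right_mono) auto
    ultimately show "g y \<le> h y" by (simp add: g_def h_def algebra_simps)
  qed
  also have "\<dots> \<le> integral {-L..L} h"
    by (rule integral_subset_le) (use x l \<kappa> in \<open>auto intro!: int hc simp: h_def\<close>)
  also have "\<dots> = (\<kappa> + l) * integral {-L..L} (\<lambda>x. (v x)\<^sup>2) + ?D / l"
    unfolding h_def
    using l by (subst Henstock_Kurzweil_Integration.integral_add) (auto intro!: int continuous_intros c)
  also have "\<dots> \<le> (\<kappa> + l) * a + ?D / l"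
    using a(1) l \<kappa> by (intro add_right_mono mult_left_mono) auto
  finally show "\<zeta> x * (v x)\<^sup>2 \<le> \<kappa> * a + l * a + ?D / l" by (simp add: algebra_simps)
qed

text \<open>Here \<kappa> is the cut-off error, \<eta> the commutator error and \<open>P\<close> the
  size of the weight. The supremum bound \<open>S\<close> enters twice: it controls the nonlinear
  term, which the dissipation \<open>D\<close> absorbs, and it dominates the left-hand side, so the
  remaining dissipation is converted into a point value.\<close>

lemma energy_lower_bound:
  fixes v v1 \<zeta> \<zeta>1 p p1 p3 g e :: "real \<Rightarrow> real"
  assumes L: "0 \<le> L"
    and v: "\<And>x. (v has_real_derivative v1 x) (at x)" "continuous_on UNIV v1" "\<And>x. \<bar>v x\<bar> \<le> 1"
      "integral {-L..L} (\<lambda>x. (v x)\<^sup>2) \<le> 1/16" "integral {-L..L} (\<lambda>x. (v1 x)\<^sup>2) \<le> 1/16"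
    and \<zeta>: "\<And>x. (\<zeta> has_real_derivative \<zeta>1 x) (at x)" "continuous_on UNIV \<zeta>1"
      "\<And>x. \<bar>\<zeta>1 x\<bar> \<le> \<kappa>" "\<zeta> (-L) = 0" "\<And>x. 0 \<le> \<zeta> x"
    and p: "continuous_on UNIV p" "continuous_on UNIV p1" "continuous_on UNIV p3"
      "\<And>x. \<bar>p1 x - (\<zeta> x)\<^sup>2\<bar> \<le> \<kappa>" "\<And>x. \<bar>p3 x\<bar> \<le> 2 * \<kappa>" "\<And>x. \<bar>p x\<bar> \<le> P" "\<And>x. \<bar>p1 x\<bar> \<le> P"
    and g: "continuous_on UNIV g" "\<And>x. \<bar>g x\<bar> \<le> 4 * (v x) ^ 6"
    and e: "continuous_on UNIV e" "\<And>x. \<bar>e x\<bar> \<le> \<eta>"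
    and x: "x \<in> {-L..L}"
  shows "(\<zeta> x * (v x)\<^sup>2)\<^sup>2 \<le> integral {-L..L} (\<lambda>x. 3/2 * p1 x * (v1 x)\<^sup>2 - 1/2 * p3 x * (v x)\<^sup>2
      - p1 x * g x - (p1 x * v x + p x * v1 x) * e x) + \<kappa> + 3 * \<kappa>\<^sup>2 + P * \<eta> * (4 * L + 1)"
proof -
  have cont: "continuous_on UNIV g" if "\<And>x. (g has_real_derivative g' x) (at x)" for g g' :: "real \<Rightarrow> real"
    using DERIV_isCont[OF that] by (simp add: continuous_at_imp_continuous_on)
  note c = cont[OF v(1)] v(2) cont[OF \<zeta>(1)] \<zeta>(2) p(1-3) g(1) e(1)
  have int: "h integrable_on {-L..L}" if "continuous_on UNIV h" for h :: "real \<Rightarrow> real"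
    by (rule integrable_continuous_real[OF continuous_on_subset[OF that]]) simp
  have \<kappa>: "0 \<le> \<kappa>" using \<zeta>(3)[of 0] by linarith
  have \<eta>: "0 \<le> \<eta>" using e(2)[of 0] by linarith
  have P: "0 \<le> P" using p(6)[of 0] by linarith
  define n where "n x = 3/2 * p1 x * (v1 x)\<^sup>2 - 1/2 * p3 x * (v x)\<^sup>2
      - p1 x * g x - (p1 x * v x + p x * v1 x) * e x" for x
  define A where "A = integral {-L..L} (\<lambda>x. (v x)\<^sup>2)"
  define A1 where "A1 = integral {-L..L} (\<lambda>x. (v1 x)\<^sup>2)"
  define D where "D = integral {-L..L} (\<lambda>x. (\<zeta> x)\<^sup>2 * (v1 x)\<^sup>2)"
  have iA: "((\<lambda>x. (v x)\<^sup>2) has_integral A) {-L..L}"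
    and iA1: "((\<lambda>x. (v1 x)\<^sup>2) has_integral A1) {-L..L}"
    and iD: "((\<lambda>x. (\<zeta> x)\<^sup>2 * (v1 x)\<^sup>2) has_integral D) {-L..L}"
    unfolding A_def A1_def D_def
    by (intro integrable_integral int continuous_intros c)+
  have AA: "A \<le> 1/16" "A1 \<le> 1/16" using v(4,5) by (auto simp: A_def A1_def)
  have A0: "0 \<le> A" "0 \<le> D" using has_integral_nonneg[OF iA] has_integral_nonneg[OF iD] by auto
  \<comment> \<open>The right-hand side of the localized sup bound with a = 1/16.\<close>
  define S where "S = 2 * (\<kappa> * (1/16))\<^sup>2 + 8 * (1/16) * D"
  have S: "(\<zeta> y * (v y)\<^sup>2)\<^sup>2 \<le> S" if "y \<in> {-L..L}" for y
    unfolding S_def D_def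
    by (rule localized_sup_bound[OF v(1,2) \<zeta> v(4) _ that \<kappa>]) simp
  have S0: "0 \<le> S" using S[OF x] by (meson order_trans zero_le_power2)
  \<comment> \<open>Of 5 \<kappa>, one \<kappa> comes from p''' and four from the part of p' not
    covered by \<zeta>^2. In the commutator term |v| <= 1 and |v1| <= 1 + v1^2 give the factor 2 +
    v1^2.\<close>
  have lower: "3/2 * ((\<zeta> y)\<^sup>2 * (v1 y)\<^sup>2) - (3/2 * \<kappa>) * (v1 y)\<^sup>2 - (5 * \<kappa> + 4 * S) * (v y)\<^sup>2
      - (P * \<eta>) * (2 + (v1 y)\<^sup>2) \<le> n y" if y: "y \<in> {-L..L}" for y
  proof -
    have 1: "((\<zeta> y)\<^sup>2 - \<kappa>) * (v1 y)\<^sup>2 \<le> p1 y * (v1 y)\<^sup>2"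
      using p(4)[of y] by (intro mult_right_mono) auto
    have 2: "p3 y * (v y)\<^sup>2 \<le> 2 * \<kappa> * (v y)\<^sup>2"
      using p(5)[of y] by (intro mult_right_mono) auto
    have v2: "(v y)\<^sup>2 \<le> 1" using v(3)[of y] by (simp add: abs_square_le_1)
    \<comment> \<open>Four of the six powers join \<zeta>^2 to form (\<zeta> v^2)^2 <= S; the
      remaining v^2 is integrated.\<close>
    have v6: "(v y) ^ 6 = ((v y)\<^sup>2 * (v y)\<^sup>2) * (v y)\<^sup>2" by (simp add: eval_nat_numeral)
    have p1: "\<bar>p1 y\<bar> \<le> (\<zeta> y)\<^sup>2 + \<kappa>"
      using p(4)[of y] abs_triangle_ineq[of "p1 y - (\<zeta> y)\<^sup>2" "(\<zeta> y)\<^sup>2"] by simp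
    have "p1 y * g y \<le> \<bar>p1 y\<bar> * \<bar>g y\<bar>" by (metis abs_ge_self abs_mult)
    also have "\<dots> \<le> ((\<zeta> y)\<^sup>2 + \<kappa>) * (4 * (v y) ^ 6)"
      using p1 \<kappa> by (intro mult_mono g(2)) auto
    also have "\<dots> = 4 * (\<zeta> y * (v y)\<^sup>2)\<^sup>2 * (v y)\<^sup>2 + 4 * \<kappa> * ((v y)\<^sup>2 * (v y)\<^sup>2) * (v y)\<^sup>2"
      unfolding v6 by (simp add: power2_eq_square algebra_simps)
    also have "\<dots> \<le> 4 * S * (v y)\<^sup>2 + 4 * \<kappa> * (1 * 1) * (v y)\<^sup>2"
      using S[OF y] v2 \<kappa> by (intro add_mono mult_right_mono mult_left_mono mult_mono) auto
    finally have 3: "p1 y * g y \<le> 4 * S * (v y)\<^sup>2 + 4 * \<kappa> * (v y)\<^sup>2" by simp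
    have "\<bar>v1 y\<bar> \<le> 1 + (v1 y)\<^sup>2"
      using sum_squares_bound[of 1 "\<bar>v1 y\<bar>"] by simp
    then have "\<bar>p y * v1 y\<bar> \<le> P * (1 + (v1 y)\<^sup>2)"
      unfolding abs_mult using p(6)[of y] P by (intro mult_mono) auto
    moreover have "\<bar>p1 y * v y\<bar> \<le> P * 1"
      unfolding abs_mult using p(7)[of y] v(3)[of y] P by (intro mult_mono) auto
    ultimately have "\<bar>p1 y * v y + p y * v1 y\<bar> \<le> P * 1 + P * (1 + (v1 y)\<^sup>2)"
      by linarith
    then have "\<bar>(p1 y * v y + p y * v1 y) * e y\<bar> \<le> (P * 1 + P * (1 + (v1 y)\<^sup>2)) * \<eta>"
      unfolding abs_mult using e(2)[of y] P by (intro mult_mono) auto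
    then have 4: "(p1 y * v y + p y * v1 y) * e y \<le> (P * \<eta>) * (2 + (v1 y)\<^sup>2)"
      by (simp add: algebra_simps)
    show ?thesis using 1 2 3 4 unfolding n_def by (simp add: algebra_simps)
  qed
  have nint: "(n has_integral integral {-L..L} n) {-L..L}"
    unfolding n_def[abs_def] by (intro integrable_integral int continuous_intros c)
  have cint: "((\<lambda>y. 2::real) has_integral 2 * (L - (-L))) {-L..L}"
    using has_integral_const_real[of "2::real" "-L" L] L by (simp add: mult.commute)
  have "3/2 * D - (3/2 * \<kappa>) * A1 - (5 * \<kappa> + 4 * S) * A - (P * \<eta>) * (2 * (L - (-L)) + A1) \<le> integral {-L..L} n"
    by (rule has_integral_le[OF _ nint lower])
       (intro has_integral_diff has_integral_add has_integral_mult_right iA iA1 iD cint)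
  moreover have "(3/2 * \<kappa>) * A1 \<le> (3/2 * \<kappa>) * (1/16)" using AA \<kappa> by (intro mult_left_mono) auto
  moreover have "(5 * \<kappa> + 4 * S) * A \<le> (5 * \<kappa> + 4 * S) * (1/16)" using AA \<kappa> S0 by (intro mult_left_mono) auto
  moreover have "(P * \<eta>) * (2 * (L - (-L)) + A1) \<le> P * \<eta> * (4 * L + 1)"
    using AA P \<eta> by (intro mult_left_mono) auto
  moreover have "S \<le> 2 * \<kappa>\<^sup>2 + D / 2"
    using zero_le_power2[of \<kappa>] by (simp add: S_def power_divide)
  moreover have "0 \<le> \<kappa>\<^sup>2" by simp
  \<comment> \<open>The absorption: moving S/4 to the left leaves 5S/4 <= 5K/2 + 5D/8, which 3D/2 +
    3K accommodates; the \<kappa> terms add up to 13/32 of \<kappa>.\<close>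
  moreover have "S \<le> M + \<kappa> + 3 * K + X"
    if "3/2 * D - a - b - c \<le> M" "a \<le> 3/2 * \<kappa> * (1/16)" "b \<le> (5 * \<kappa> + 4 * S) * (1/16)" "c \<le> X"
      "S \<le> 2 * K + D / 2" "0 \<le> K" for a b c M X K
    using that A0(2) \<kappa> by (simp add: field_simps)
  ultimately have "S \<le> integral {-L..L} n + \<kappa> + 3 * \<kappa>\<^sup>2 + P * \<eta> * (4 * L + 1)"
    by blast
  with S[OF x] show ?thesis by (simp add: n_def[abs_def])
qed

section \<open>Virial weights\<close>

lemma bounded_if_compact_support:
  fixes f :: "real \<Rightarrow> real"
  assumes "continuous_on UNIV f" "\<And>x. R < \<bar>x\<bar> \<Longrightarrow> f x = 0"
  obtains M where "0 < M" "\<And>x. \<bar>f x\<bar> \<le> M"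
proof -
  have "compact (f ` {-R..R})"
    by (intro compact_continuous_image continuous_on_subset[OF assms(1)]) auto
  then obtain B where B: "\<And>x. x \<in> {-R..R} \<Longrightarrow> \<bar>f x\<bar> \<le> B"
    by (meson bounded_real compact_imp_bounded imageI)
  show thesis
  proof (rule that)
    show "0 < \<bar>B\<bar> + 1" by simp
    fix x show "\<bar>f x\<bar> \<le> \<bar>B\<bar> + 1"
      using B[of x] assms(2)[of x] by (cases "R < \<bar>x\<bar>") (auto simp: abs_if split: if_splits)
  qed
qed

text \<open>
  The weight is \<open>p(x) = R (\<Theta>(x/R) - \<Theta>(x/R\<^sup>2))\<close> with \<open>\<Theta>' = b\<^sup>2\<close>. A compactly supported weight cannot be
  increasing; the second term lets \<open>p\<close> descend over the long scale \<open>R\<^sup>2\<close> with slope only \<open>O(1/R)\<close>.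
\<close>

lemma virial_weights:
  obtains b :: "real \<Rightarrow> real" and T :: real where "continuous_on UNIV b" "0 < b 0" "0 < T"
    "\<And>x. 0 \<le> b x" "\<And>x. (b x)\<^sup>2 \<le> T"
    "\<And>R. 1 \<le> R \<Longrightarrow> \<exists>\<zeta>1 p p1 p2 p3 P.
       (\<forall>x. ((\<lambda>x. b (x / R)) has_real_derivative \<zeta>1 x) (at x)) \<and> continuous_on UNIV \<zeta>1 \<and>
       (\<forall>x. \<bar>\<zeta>1 x\<bar> \<le> T / R) \<and> b (-(R\<^sup>2) / R) = 0 \<and>
       (\<forall>x. (p has_real_derivative p1 x) (at x)) \<and> (\<forall>x. (p1 has_real_derivative p2 x) (at x)) \<and>
       (\<forall>x. (p2 has_real_derivative p3 x) (at x)) \<and> continuous_on UNIV p3 \<and>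
       p (R\<^sup>2) = 0 \<and> p (-(R\<^sup>2)) = 0 \<and> p1 (R\<^sup>2) = 0 \<and> p1 (-(R\<^sup>2)) = 0 \<and> p2 (R\<^sup>2) = 0 \<and> p2 (-(R\<^sup>2)) = 0 \<and>
       (\<forall>x. \<bar>p1 x - (b (x / R))\<^sup>2\<bar> \<le> T / R) \<and> (\<forall>x. \<bar>p3 x\<bar> \<le> 2 * (T / R)) \<and>
       (\<forall>x. \<bar>p x\<bar> \<le> P) \<and> (\<forall>x. \<bar>p1 x\<bar> \<le> P)"
proof -
  obtain b :: "real \<Rightarrow> real" where b: "\<And>n. class_C n b" "\<And>x. 0 \<le> b x" "0 < b 0"
    "mollifier 1 (\<lambda>x. (b x)\<^sup>2)"
    using unit_bump_exists by blast
  define \<theta> where "\<theta> x = (b x)\<^sup>2" for x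
  have \<theta>: "mollifier 1 \<theta>" using b(4) by (simp add: \<theta>_def[abs_def])
  note \<theta>n = mollifier_higher_deriv[OF \<theta>]
  define \<theta>1 \<theta>2 where "\<theta>1 = (deriv ^^ 1) \<theta>" and "\<theta>2 = (deriv ^^ 2) \<theta>"
  have \<theta>': "(\<theta> has_real_derivative \<theta>1 x) (at x)" "(\<theta>1 has_real_derivative \<theta>2 x) (at x)" for x
    using \<theta>n(4)[of 0 x] \<theta>n(4)[of 1 x] by (simp_all add: \<theta>1_def \<theta>2_def eval_nat_numeral)
  obtain \<Theta> where \<Theta>: "\<And>x. (\<Theta> has_real_derivative \<theta> x) (at x)" "\<And>x. x \<le> -1 \<Longrightarrow> \<Theta> x = 0"
    "\<And>x. 1 \<le> x \<Longrightarrow> \<Theta> x = 1" "\<And>x. 0 \<le> \<Theta> x" "\<And>x. \<Theta> x \<le> 1"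
    using mollifier_antiderivative[OF \<theta>] by blast
  have bc: "continuous_on UNIV b" using class_C_imp_continuous[OF b(1)] .
  have b'c: "continuous_on UNIV (deriv b)" using b(1)[of "Suc 0"] by (simp add: class_C_Suc)
  have b0: "b x = 0" if "1 \<le> \<bar>x\<bar>" for x
    using mollifierD(3)[OF b(4) that] by simp
  have b1: "deriv b x = 0" if "1 < \<bar>x\<bar>" for x
    by (rule deriv_eq_0_outside[OF _ that]) (use b0 in auto)
  \<comment> \<open>The endpoints of the virial interval scale to exactly -1 and 1 in the second
    term, so vanishing at |x| = 1 is required; it follows from \<theta>1 = 2 b b'.\<close>
  have \<theta>10: "\<theta>1 x = 0" if "1 \<le> \<bar>x\<bar>" for x
  proof -
    have "(\<theta> has_real_derivative 2 * b x * deriv b x) (at x)"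
      unfolding \<theta>_def by (rule DERIV_cong, (rule derivative_intros class_C_Suc_DERIV[OF b(1)])+) simp
    then have "\<theta>1 x = 2 * b x * deriv b x" using \<theta>'(1) DERIV_unique by blast
    then show ?thesis using b0[OF that] by simp
  qed
  obtain T0 where T0: "0 < T0" "\<And>x. \<bar>\<theta> x\<bar> \<le> T0"
    using bounded_if_compact_support[OF mollifierD(5)[OF \<theta>], of 1] mollifierD(3)[OF \<theta>] by (metis less_imp_le)
  obtain T1 where T1: "0 < T1" "\<And>x. \<bar>deriv b x\<bar> \<le> T1"
    using bounded_if_compact_support[OF b'c b1] by blast
  obtain T2 where T2: "0 < T2" "\<And>x. \<bar>\<theta>2 x\<bar> \<le> T2"
    using bounded_if_compact_support[OF \<theta>n(3)[of 2] \<theta>n(2)[of _ 2]] unfolding \<theta>2_def by blast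
  define T where "T = T0 + T1 + T2"
  have T: "0 < T" "\<bar>\<theta> x\<bar> \<le> T" "\<bar>deriv b x\<bar> \<le> T" "\<bar>\<theta>2 x\<bar> \<le> T" for x
    using T0(1) T1(1) T2(1) T0(2)[of x] T1(2)[of x] T2(2)[of x] by (auto simp: T_def)
  show thesis
  proof (rule that[OF bc b(3) T(1) b(2)])
    show "(b x)\<^sup>2 \<le> T" for x using T(2)[of x] by (simp add: \<theta>_def)
    fix R :: real assume R: "1 \<le> R"
    then have R0: "R > 0" "R * R > 0" "R\<^sup>2 \<ge> 1" by auto
    define \<zeta>1 where "\<zeta>1 x = deriv b (x / R) / R" for x
    define p where "p x = R * \<Theta> (x / R) - R * \<Theta> (x / R\<^sup>2)" for x
    define p1 where "p1 x = \<theta> (x / R) - \<theta> (x / R\<^sup>2) / R" for x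
    define p2 where "p2 x = \<theta>1 (x / R) / R - \<theta>1 (x / R\<^sup>2) / R ^ 3" for x
    define p3 where "p3 x = \<theta>2 (x / R) / R\<^sup>2 - \<theta>2 (x / R\<^sup>2) / R ^ 5" for x
    have scale: "((\<lambda>x. h (x / c)) has_real_derivative h' (x / c) / c) (at x)"
      if "\<And>x. (h has_real_derivative h' x) (at x)" for h h' :: "real \<Rightarrow> real" and c x
      using DERIV_chain2[OF that DERIV_cdivide[OF DERIV_ident], of c x UNIV] by simp
    note sc = scale[OF \<Theta>(1)] scale[OF \<theta>'(1)] scale[OF \<theta>'(2)]
    \<comment> \<open>With L = R^2 the arguments at the ends are -R, R and -1, 1: both copies of
      \<Theta> have reached their constant values and cancel.\<close>
    have ends: "R\<^sup>2 / R = R" "- (R\<^sup>2) / R = - R" "R\<^sup>2 / R\<^sup>2 = 1" "- (R\<^sup>2) / R\<^sup>2 = -1"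
      using R0 by (auto simp: power2_eq_square)
    have \<theta>0: "\<theta> x = 0" if "1 \<le> \<bar>x\<bar>" for x using mollifierD(3)[OF \<theta> that] .
    have inv_le: "T / R ^ n \<le> T / R" if "n \<ge> 1" for n
      using that R T(1) R0(1) self_le_power[OF R] by (intro divide_left_mono) auto
    have sum2: "\<bar>x / R ^ m - y / R ^ n\<bar> \<le> 2 * (T / R)" if "\<bar>x\<bar> \<le> T" "\<bar>y\<bar> \<le> T" "m \<ge> 1" "n \<ge> 1" for x y m n
    proof -
      have "\<bar>x / R ^ m\<bar> \<le> T / R ^ m" "\<bar>y / R ^ n\<bar> \<le> T / R ^ n"
        using that R0 by (auto simp: abs_divide intro!: divide_right_mono)
      then show ?thesis using inv_le[OF that(3)] inv_le[OF that(4)] by linarith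
    qed
    have "((\<lambda>x. b (x / R)) has_real_derivative \<zeta>1 x) (at x)" for x
      unfolding \<zeta>1_def by (rule scale) (rule class_C_Suc_DERIV[OF b(1)])
    moreover have "continuous_on UNIV \<zeta>1"
      unfolding \<zeta>1_def using R0 by (auto intro!: continuous_intros continuous_on_compose2[OF b'c])
    moreover have "\<bar>\<zeta>1 x\<bar> \<le> T / R" for x
      using T(3)[of "x / R"] R0 by (auto simp: \<zeta>1_def abs_divide intro!: divide_right_mono)
    moreover have "b (- (R\<^sup>2) / R) = 0" using R unfolding ends by (intro b0) simp
    moreover have "(p has_real_derivative p1 x) (at x)" for x
      unfolding p_def p1_def
      by (rule DERIV_cong, (rule derivative_intros sc)+) (use R0 in \<open>simp add: field_simps power2_eq_square\<close>)
    moreover have "(p1 has_real_derivative p2 x) (at x)" for x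
      unfolding p1_def p2_def
      by (rule DERIV_cong, (rule DERIV_diff DERIV_cdivide sc)+) (use R0 in \<open>simp add: field_simps eval_nat_numeral\<close>)
    moreover have "(p2 has_real_derivative p3 x) (at x)" for x
      unfolding p2_def p3_def
      by (rule DERIV_cong, (rule DERIV_diff DERIV_cdivide sc)+) (use R0 in \<open>simp add: field_simps eval_nat_numeral\<close>)
    moreover have "continuous_on UNIV p3"
      unfolding p3_def \<theta>2_def using R0 by (auto intro!: continuous_intros continuous_on_compose2[OF \<theta>n(3)])
    moreover have "p (R\<^sup>2) = 0" "p (-(R\<^sup>2)) = 0" "p1 (R\<^sup>2) = 0" "p1 (-(R\<^sup>2)) = 0" "p2 (R\<^sup>2) = 0" "p2 (-(R\<^sup>2)) = 0"
      using R unfolding p_def p1_def p2_def ends by (auto simp: \<Theta>(2,3) \<theta>0 \<theta>10)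
    moreover have "\<bar>p1 x - (b (x / R))\<^sup>2\<bar> \<le> T / R" for x
      using T(2)[of "x / R\<^sup>2"] R0 by (auto simp: p1_def \<theta>_def abs_divide intro!: divide_right_mono)
    moreover have "\<bar>p3 x\<bar> \<le> 2 * (T / R)" for x
      unfolding p3_def by (intro sum2 T) auto
    \<comment> \<open>One constant serves both p, bounded by R, and p1, bounded by 2 T. It grows
      with R, which is harmless because R is fixed while the mollification is removed.\<close>
    moreover have "\<bar>p x\<bar> \<le> R + 2 * T" for x
    proof -
      have "\<bar>\<Theta> (x / R) - \<Theta> (x / R\<^sup>2)\<bar> \<le> 1"
        using \<Theta>(4,5)[of "x / R"] \<Theta>(4,5)[of "x / R\<^sup>2"] by linarith
      then have "R * \<bar>\<Theta> (x / R) - \<Theta> (x / R\<^sup>2)\<bar> \<le> R * 1" using R0 by (intro mult_left_mono) auto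
      then have "\<bar>p x\<bar> \<le> R" using R0 by (simp add: p_def abs_mult right_diff_distrib[symmetric])
      then show ?thesis using T(1) by simp
    qed
    moreover have "\<bar>p1 x\<bar> \<le> R + 2 * T" for x
    proof -
      have "\<bar>\<theta> (x / R\<^sup>2) / R\<bar> \<le> T / 1"
        unfolding abs_divide using R R0 T by (intro frac_le) auto
      then show ?thesis using T(2)[of "x / R"] R0 unfolding p1_def by linarith
    qed
    ultimately show "\<exists>\<zeta>1 p p1 p2 p3 P.
       (\<forall>x. ((\<lambda>x. b (x / R)) has_real_derivative \<zeta>1 x) (at x)) \<and> continuous_on UNIV \<zeta>1 \<and>
       (\<forall>x. \<bar>\<zeta>1 x\<bar> \<le> T / R) \<and> b (-(R\<^sup>2) / R) = 0 \<and>
       (\<forall>x. (p has_real_derivative p1 x) (at x)) \<and> (\<forall>x. (p1 has_real_derivative p2 x) (at x)) \<and>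
       (\<forall>x. (p2 has_real_derivative p3 x) (at x)) \<and> continuous_on UNIV p3 \<and>
       p (R\<^sup>2) = 0 \<and> p (-(R\<^sup>2)) = 0 \<and> p1 (R\<^sup>2) = 0 \<and> p1 (-(R\<^sup>2)) = 0 \<and> p2 (R\<^sup>2) = 0 \<and> p2 (-(R\<^sup>2)) = 0 \<and>
       (\<forall>x. \<bar>p1 x - (b (x / R))\<^sup>2\<bar> \<le> T / R) \<and> (\<forall>x. \<bar>p3 x\<bar> \<le> 2 * (T / R)) \<and>
       (\<forall>x. \<bar>p x\<bar> \<le> P) \<and> (\<forall>x. \<bar>p1 x\<bar> \<le> P)"
      by (intro exI[of _ \<zeta>1] exI[of _ p] exI[of _ p1] exI[of _ p2] exI[of _ p3] exI[of _ "R + 2 * T"]) blast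
  qed
qed

text \<open>An average of values near c is near c. It is applied with c = 0 to bound the mollified
  solution and with c = f(v(x)) to bound the commutator.\<close>

lemma conv_approx_const:
  assumes k: "mollifier \<delta> k" and h: "continuous_on UNIV h"
    and close: "\<And>y. \<bar>y - x\<bar> \<le> \<delta> \<Longrightarrow> \<bar>h y - c\<bar> \<le> B"
  shows "\<bar>conv k h x - c\<bar> \<le> B"
proof -
  note kD = mollifierD[OF k] and kr = mollifier_reflect_integrals[OF k]
  have i: "integrable lborel (\<lambda>y. k (x - y) * h y)"
    by (rule integrable_compact_support_Icc(1)[of _ "x - \<delta>" "x + \<delta>"])
       (auto intro!: continuous_intros h continuous_on_compose2[OF kD(5)] kD(3))
  have "conv k h x - c = (LINT y|lborel. k (x - y) * h y - c * k (x - y))"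
    using i kr(2,3)[of x] by (simp add: conv_def)
  also have "\<bar>\<dots>\<bar> \<le> (LINT y|lborel. B * k (x - y))"
  proof (rule integral_abs_bound_integral)
    show "integrable lborel (\<lambda>y. k (x - y) * h y - c * k (x - y))"
      using i kr(2)[of x] by auto
    show "integrable lborel (\<lambda>y. B * k (x - y))" using kr(2)[of x] by auto
    fix y
    have "k (x - y) * \<bar>h y - c\<bar> \<le> k (x - y) * B"
    proof (cases "\<bar>y - x\<bar> \<le> \<delta>")
      case True
      then show ?thesis using close kD(2) by (intro mult_left_mono) auto
    next
      case False
      then have "k (x - y) = 0" by (intro kD(3)) auto
      then show ?thesis by simp
    qed
    moreover have "k (x - y) * h y - c * k (x - y) = k (x - y) * (h y - c)"
      by (simp add: algebra_simps)
    then have "\<bar>k (x - y) * h y - c * k (x - y)\<bar> = k (x - y) * \<bar>h y - c\<bar>"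
      using kD(2)[of "x - y"] by (simp only: abs_mult abs_of_nonneg)
    ultimately show "\<bar>k (x - y) * h y - c * k (x - y)\<bar> \<le> B * k (x - y)" by (simp add: mult.commute)
  qed
  also have "\<dots> = B" using kr(3)[of x] by simp
  finally show ?thesis .
qed

lemma integral_le_L2_norm:
  assumes "in_L2 g" "continuous_on UNIV g"
  shows "integral {a..b} (\<lambda>x. (g x)\<^sup>2) \<le> (L2_norm g)\<^sup>2"
proof -
  have i: "set_integrable lborel {a..b} (\<lambda>x. (g x)\<^sup>2)"
    by (rule borel_integrable_atLeastAtMost')
       (use assms(2) in \<open>auto intro!: continuous_intros intro: continuous_on_subset\<close>)
  have "integral {a..b} (\<lambda>x. (g x)\<^sup>2) = (LINT x|lborel. indicator {a..b} x * (g x)\<^sup>2)"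
    using set_borel_integral_eq_integral(2)[OF i] by (simp add: set_lebesgue_integral_def)
  also have "\<dots> \<le> (LINT x|lborel. (g x)\<^sup>2)"
    using i assms(1) by (intro integral_mono) (auto simp: set_integrable_def in_L2_def indicator_def)
  finally show ?thesis by (simp add: L2_norm_power2)
qed

lemma power4_diff_le:
  fixes a b :: real
  assumes "\<bar>a\<bar> \<le> 1" "\<bar>b\<bar> \<le> 1"
  shows "a ^ 4 \<le> b ^ 4 + 4 * \<bar>a - b\<bar>"
proof -
  have "a ^ 4 - b ^ 4 = (a - b) * ((a + b) * (a\<^sup>2 + b\<^sup>2))"
    by (simp add: eval_nat_numeral algebra_simps)
  also have "\<dots> \<le> \<bar>a - b\<bar> * (\<bar>a + b\<bar> * \<bar>a\<^sup>2 + b\<^sup>2\<bar>)"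
    by (metis abs_ge_self abs_mult)
  also have "\<dots> \<le> \<bar>a - b\<bar> * (2 * 2)"
    using assms abs_square_le_1[of a] abs_square_le_1[of b] by (intro mult_left_mono mult_mono) auto
  finally show ?thesis by simp
qed

section \<open>Small periodic solutions\<close>

text \<open>Joint continuity combines two uniform estimates: time slices are close in supremum norm
  because the representative of their difference is bounded by its H^1 norm, and each slice is
  Hoelder in x with the same constant.\<close>

lemma H1_curve_continuous_representative:
  assumes H1: "\<And>t. in_H1 (u t)" and bd: "\<And>t. H1_norm (u t) \<le> \<epsilon>"
    and cont: "\<And>t. ((\<lambda>s. H1_norm (\<lambda>x. u s x - u t x)) \<longlongrightarrow> 0) (at t)"
  obtains U :: "real \<Rightarrow> real \<Rightarrow> real" where
    "continuous_on UNIV (\<lambda>p. U (fst p) (snd p))" "\<And>t. continuous_on UNIV (U t)"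
    "\<And>t. AE x in lborel. u t x = U t x"
    "\<And>t a b. \<bar>U t b - U t a\<bar> \<le> \<epsilon> * sqrt \<bar>b - a\<bar>" "\<And>t x. \<bar>U t x\<bar> \<le> 2 * \<epsilon>"
    "\<And>t \<delta> k x. mollifier \<delta> k \<Longrightarrow> \<bar>conv k (u t) x - U t x\<bar> \<le> \<epsilon> * sqrt (2 * \<delta>)"
proof -
  define Rep where "Rep t V \<longleftrightarrow> continuous_on UNIV V \<and> (AE x in lborel. u t x = V x) \<and>
    (\<forall>a b. \<bar>V b - V a\<bar> \<le> \<epsilon> * sqrt \<bar>b - a\<bar>) \<and> (\<forall>x. \<bar>V x\<bar> \<le> 2 * \<epsilon>) \<and>
    (\<forall>\<delta> k x. mollifier \<delta> k \<longrightarrow> \<bar>conv k (u t) x - V x\<bar> \<le> \<epsilon> * sqrt (2 * \<delta>))" for t V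
  have "\<exists>V. Rep t V" for t
  proof -
    obtain V where V: "continuous_on UNIV V" "AE x in lborel. u t x = V x"
      "\<And>a b. \<bar>V b - V a\<bar> \<le> H1_norm (u t) * sqrt \<bar>b - a\<bar>" "\<And>x. \<bar>V x\<bar> \<le> 2 * H1_norm (u t)"
      "\<And>\<delta> k x. mollifier \<delta> k \<Longrightarrow> \<bar>conv k (u t) x - V x\<bar> \<le> H1_norm (u t) * sqrt (2 * \<delta>)"
      using H1_continuous_representative[OF H1[of t]] by blast
    have up: "y \<le> \<epsilon> * s" if "y \<le> H1_norm (u t) * s" "0 \<le> s" for y s
      using mult_right_mono[OF bd[of t] that(2)] that(1) by simp
    have "\<bar>V x\<bar> \<le> 2 * \<epsilon>" for x using V(4)[of x] bd[of t] by simp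
    moreover have "\<bar>V b - V a\<bar> \<le> \<epsilon> * sqrt \<bar>b - a\<bar>" for a b
      by (rule up[OF V(3)]) simp
    moreover have "\<bar>conv k (u t) x - V x\<bar> \<le> \<epsilon> * sqrt (2 * \<delta>)" if "mollifier \<delta> k" for \<delta> k x
      by (rule up[OF V(5)[OF that]]) (use mollifierD(6)[OF that] in simp)
    ultimately show ?thesis unfolding Rep_def using V(1,2) by blast
  qed
  then obtain U where Rep: "\<And>t. Rep t (U t)" by metis
  have U: "\<And>t. continuous_on UNIV (U t)" "\<And>t. AE x in lborel. u t x = U t x"
    "\<And>t a b. \<bar>U t b - U t a\<bar> \<le> \<epsilon> * sqrt \<bar>b - a\<bar>" "\<And>t x. \<bar>U t x\<bar> \<le> 2 * \<epsilon>"
    "\<And>t \<delta> k x. mollifier \<delta> k \<Longrightarrow> \<bar>conv k (u t) x - U t x\<bar> \<le> \<epsilon> * sqrt (2 * \<delta>)"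
    using Rep[unfolded Rep_def] by blast+
  have diff: "\<bar>U s x - U t x\<bar> \<le> 2 * H1_norm (\<lambda>x. u s x - u t x)" for s t x
  proof -
    obtain W where W: "continuous_on UNIV W" "AE x in lborel. u s x - u t x = W x"
      "\<And>a b. \<bar>W b - W a\<bar> \<le> H1_norm (\<lambda>x. u s x - u t x) * sqrt \<bar>b - a\<bar>"
      "\<And>x. \<bar>W x\<bar> \<le> 2 * H1_norm (\<lambda>x. u s x - u t x)"
      "\<And>\<delta> k x. mollifier \<delta> k \<Longrightarrow> \<bar>conv k (\<lambda>x. u s x - u t x) x - W x\<bar> \<le> H1_norm (\<lambda>x. u s x - u t x) * sqrt (2 * \<delta>)"
      using H1_continuous_representative[OF in_H1_diff[OF H1[of s] H1[of t]]] by blast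
    have "AE x in lborel. U s x - U t x = W x"
      using U(2)[of s] U(2)[of t] W(2) by eventually_elim simp
    then have "U s x - U t x = W x"
      by (rule continuous_AE_eq_imp_eq[rotated 2]) (intro continuous_intros U(1) W(1))+
    then show ?thesis using W(4)[of x] by simp
  qed
  have "continuous_on UNIV (\<lambda>p. U (fst p) (snd p))"
    unfolding continuous_on_def
  proof
    fix z :: "real \<times> real"
    obtain t x where z: "z = (t, x)" by force
    \<comment> \<open>Set to 0 at s = t because a limit at t ignores that point; this avoids
      evaluating \<open>H1_norm\<close> of the zero function, whose weak derivative is a
      choice.\<close>
    define N where "N s = (if s = t then 0 else 2 * H1_norm (\<lambda>x. u s x - u t x))" for s
    have "((\<lambda>s. 2 * H1_norm (\<lambda>x. u s x - u t x)) \<longlongrightarrow> 2 * 0) (at t)"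
      by (intro tendsto_intros cont)
    moreover have "eventually (\<lambda>s. 2 * H1_norm (\<lambda>x. u s x - u t x) = N s) (at t)"
      by (simp add: N_def eventually_at_filter)
    ultimately have "(N \<longlongrightarrow> 0) (at t)" using Lim_transform_eventually by fastforce
    then have N: "isCont N t" by (simp add: isCont_def N_def)
    have "((\<lambda>p. N (fst p) + \<epsilon> * sqrt \<bar>snd p - x\<bar>) \<longlongrightarrow> N (fst z) + \<epsilon> * sqrt \<bar>snd z - x\<bar>) (at z)"
    proof (intro tendsto_intros)
      show "((\<lambda>p. N (fst p)) \<longlongrightarrow> N (fst z)) (at z)"
        by (rule isCont_tendsto_compose) (use N in \<open>auto simp: z intro!: tendsto_eq_intros\<close>)
    qed
    then have "((\<lambda>p. N (fst p) + \<epsilon> * sqrt \<bar>snd p - x\<bar>) \<longlongrightarrow> 0) (at z)" by (simp add: z N_def)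
    moreover have "\<bar>U (fst p) (snd p) - U t x\<bar> \<le> N (fst p) + \<epsilon> * sqrt \<bar>snd p - x\<bar>" for p
    proof -
      have "\<bar>U (fst p) (snd p) - U t (snd p)\<bar> \<le> N (fst p)"
        using diff[of "fst p" "snd p" t] by (simp add: N_def)
      then show ?thesis using U(3)[of t "snd p" x] by linarith
    qed
    ultimately have "((\<lambda>p. U (fst p) (snd p) - U t x) \<longlongrightarrow> 0) (at z)"
      by (intro Lim_null_comparison[of "\<lambda>p. U (fst p) (snd p) - U t x"]) auto
    then show "((\<lambda>p. U (fst p) (snd p)) \<longlongrightarrow> U (fst z) (snd z)) (at z within UNIV)"
      using LIM_zero_cancel by (fastforce simp: z)
  qed
  then show thesis using that U by blast
qed

text \<open>\<open>U\<close> is the jointly continuous representative of \<open>u\<close>, to which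
  all pointwise statements refer. At s = 0 the assumption \<open>nonlin\<close> normalizes F by F(0)
  = 0.\<close>

locale small_periodic_gKdV =
  fixes f F :: "real \<Rightarrow> real" and u U :: "real \<Rightarrow> real \<Rightarrow> real" and \<epsilon> s0 \<omega> :: real
  assumes f: "continuous_on UNIV f" and F: "\<And>s. (F has_real_derivative f s) (at s)"
    and nonlin: "\<And>s. \<bar>s\<bar> \<le> s0 \<Longrightarrow> \<bar>s * f s - F s\<bar> \<le> 4 * s ^ 6"
    and eps: "0 < \<epsilon>" "\<epsilon> \<le> 1/4" "2 * \<epsilon> \<le> s0" "s0 \<le> 1"
    and H1: "\<And>t. in_H1 (u t)" and bd: "\<And>t. H1_norm (u t) \<le> \<epsilon>"
    and sol: "solves_gKdV f u"
    and \<omega>: "0 < \<omega>" and per: "\<And>t. AE x in lborel. u (t + \<omega>) x = u t x"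
    and U: "continuous_on UNIV (\<lambda>p. U (fst p) (snd p))" "\<And>t. continuous_on UNIV (U t)"
    "\<And>t. AE x in lborel. u t x = U t x"
    "\<And>t a b. \<bar>U t b - U t a\<bar> \<le> \<epsilon> * sqrt \<bar>b - a\<bar>" "\<And>t x. \<bar>U t x\<bar> \<le> 2 * \<epsilon>"
    "\<And>t \<delta> k x. mollifier \<delta> k \<Longrightarrow> \<bar>conv k (u t) x - U t x\<bar> \<le> \<epsilon> * sqrt (2 * \<delta>)"
begin

lemma U_periodic: "U (t + \<omega>) x = U t x"
proof (rule continuous_AE_eq_imp_eq[OF U(2) U(2)])
  show "AE x in lborel. U (t + \<omega>) x = U t x"
    using per[of t] U(3)[of t] U(3)[of "t + \<omega>"] by eventually_elim simp
qed

lemma u_L2: "in_L2 (u t)" and u_measurable: "u t \<in> borel_measurable borel"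
  using H1[of t] by (auto simp: in_H1_def in_L2_def)

lemma U_measurable: "U t \<in> borel_measurable borel"
  using U(2) by (rule borel_measurable_continuous_onI)

lemma fU_cont: "continuous_on UNIV (\<lambda>p. f (U (fst p) (snd p)))" "continuous_on UNIV (\<lambda>x. f (U t x))"
  by (rule continuous_on_compose2[OF f U(1)] continuous_on_compose2[OF f U(2)], simp)+

lemma continuous_on_slice:
  fixes g :: "real \<times> real \<Rightarrow> real"
  assumes "continuous_on UNIV g"
  shows "continuous_on UNIV (\<lambda>x. g (t, x))" "continuous_on UNIV (\<lambda>t. g (t, x))"
  by (rule continuous_on_compose2[OF assms]; auto intro!: continuous_intros)+

text \<open>The weight is fixed and only the mollification is removed. The virial integral
  \<open>N\<close> is the time derivative of -1/2 \<integral>p v^2, so it integrates to 0 over a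
  period and only the error terms of the pointwise lower bound remain.\<close>

lemma localized_bound:
  assumes L: "0 \<le> L"
    and \<zeta>: "\<And>x. (\<zeta> has_real_derivative \<zeta>1 x) (at x)" "continuous_on UNIV \<zeta>1"
      "\<And>x. \<bar>\<zeta>1 x\<bar> \<le> \<kappa>" "\<zeta> (-L) = 0" "\<And>x. 0 \<le> \<zeta> x" "\<And>x. (\<zeta> x)\<^sup>2 \<le> T"
    and p: "\<And>x. (p has_real_derivative p1 x) (at x)" "\<And>x. (p1 has_real_derivative p2 x) (at x)"
      "\<And>x. (p2 has_real_derivative p3 x) (at x)" "continuous_on UNIV p3"
      "p L = 0" "p (-L) = 0" "p1 L = 0" "p1 (-L) = 0" "p2 L = 0" "p2 (-L) = 0"
      "\<And>x. \<bar>p1 x - (\<zeta> x)\<^sup>2\<bar> \<le> \<kappa>" "\<And>x. \<bar>p3 x\<bar> \<le> 2 * \<kappa>" "\<And>x. \<bar>p x\<bar> \<le> P" "\<And>x. \<bar>p1 x\<bar> \<le> P"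
    and x: "x \<in> {-L..L}"
  shows "integral {a..a+\<omega>} (\<lambda>t. (\<zeta> x * (U t x)\<^sup>2)\<^sup>2) \<le> \<omega> * (\<kappa> + 3 * \<kappa>\<^sup>2)"
proof (rule field_le_epsilon)
  have cont: "continuous_on UNIV g" if "\<And>x. (g has_real_derivative g' x) (at x)" for g g' :: "real \<Rightarrow> real"
    using DERIV_isCont[OF that] by (simp add: continuous_at_imp_continuous_on)
  note pc = cont[OF p(1)] cont[OF p(2)] p(4)
  have T: "0 \<le> T" using \<zeta>(6)[of 0] by (meson order_trans zero_le_power2)
  have P: "0 \<le> P" using p(13)[of 0] by linarith
  fix e0 :: real assume "e0 > 0"
  \<comment> \<open>Over a period the errors are e from the commutator and 4 T e from passing from V
    back to U; this makes them sum to e0.\<close>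
  define e where "e = e0 / (\<omega> * (1 + 4 * T))"
  have e: "0 < e" using \<open>e0 > 0\<close> \<omega> T by (simp add: e_def)
  define C where "C = P * (4 * L + 1) + 1"
  have C: "0 < C" using P L by (simp add: C_def add_nonneg_pos)
  define \<eta> where "\<eta> = e / C"
  have \<eta>: "0 < \<eta>" "P * \<eta> * (4 * L + 1) \<le> e"
  proof -
    show "0 < \<eta>" using e C by (simp add: \<eta>_def)
    have "\<eta> * (P * (4 * L + 1)) \<le> \<eta> * C" using \<open>0 < \<eta>\<close> by (intro mult_left_mono) (auto simp: C_def)
    also have "\<eta> * C = e" using C by (simp add: \<eta>_def)
    finally show "P * \<eta> * (4 * L + 1) \<le> e" by (simp add: mult.assoc mult.left_commute)
  qed
  have "uniformly_continuous_on {-1..1} f"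
    by (rule compact_uniformly_continuous[OF continuous_on_subset[OF f]]) auto
  then obtain d where d: "0 < d" "\<And>s s'. s \<in> {-1..1} \<Longrightarrow> s' \<in> {-1..1} \<Longrightarrow> \<bar>s' - s\<bar> < d \<Longrightarrow> \<bar>f s' - f s\<bar> < \<eta>"
    using \<eta>(1) unfolding uniformly_continuous_on_def dist_real_def by metis
  \<comment> \<open>2 r <= d leaves room for two errors, from U(y) to U(x) and from U(x) to V(x),
    inside the modulus of continuity of f; r <= e serves the fourth powers.\<close>
  define r where "r = min d e / 2"
  have r: "0 < r" "2 * r \<le> d" "r \<le> e" using d(1) e by (auto simp: r_def)
  \<comment> \<open>Chosen so that the mollification rate sqrt(2 \<delta>) is exactly r.\<close>
  define \<delta> where "\<delta> = r\<^sup>2 / 2"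
  have \<delta>: "0 < \<delta>" "sqrt (2 * \<delta>) = r" "sqrt \<delta> \<le> r"
    using r(1) by (auto simp: \<delta>_def intro: real_le_lsqrt)
  have \<epsilon>r: "\<epsilon> * y < r" if "y \<le> r" for y
  proof -
    have "\<epsilon> * y \<le> \<epsilon> * r" using eps that by (intro mult_left_mono) auto
    also have "\<dots> < 1 * r" using eps r(1) by (intro mult_strict_right_mono) auto
    finally show ?thesis by simp
  qed
  obtain k where k: "mollifier \<delta> k" using mollifier_exists[OF \<delta>(1)] by blast
  note kn = mollifier_higher_deriv[OF k]
  define V where "V n t x = conv ((deriv ^^ n) k) (U t) x" for n t x
  define Q where "Q n t x = conv ((deriv ^^ n) k) (\<lambda>y. f (U t y)) x" for n t x
  have Vc: "continuous_on UNIV (\<lambda>z. V n (fst z) (snd z))" for n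
    unfolding V_def by (rule continuous_on_conv[OF kn(3) kn(2) U(1)])
  have Qc: "continuous_on UNIV (\<lambda>z. Q n (fst z) (snd z))" for n
    unfolding Q_def by (rule continuous_on_conv[OF kn(3) kn(2) fU_cont(1)])
  note Vt = continuous_on_slice(1)[OF Vc, simplified] and Vx = continuous_on_slice(2)[OF Vc, simplified]
  note Qt = continuous_on_slice(1)[OF Qc, simplified] and Qx = continuous_on_slice(2)[OF Qc, simplified]
  have V': "(V n t has_real_derivative V (Suc n) t x) (at x)" for n t x
    unfolding V_def by (rule conv_DERIV[OF kn(4) kn(3) kn(2) kn(2) U(2)])
  have Q': "(Q n t has_real_derivative Q (Suc n) t x) (at x)" for n t x
    unfolding Q_def by (rule conv_DERIV[OF kn(4) kn(3) kn(2) kn(2) fU_cont(2)])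
  have Vt': "((\<lambda>s. V 0 s x) has_real_derivative - (V 3 t x + Q 1 t x)) (at t)" for t x
    using solves_gKdV_conv_DERIV[OF k sol f u_measurable U(3) U(2)] by (simp add: V_def Q_def)
  have Vu: "V n t = conv ((deriv ^^ n) k) (u t)" for n t
    unfolding V_def by (rule ext) (rule conv_cong_AE[OF k U_measurable u_measurable], use U(3)[of t] in \<open>auto elim: eventually_mono\<close>)
  have VU: "\<bar>V 0 t x - U t x\<bar> < r" for t x
  proof -
    have "\<bar>V 0 t x - U t x\<bar> \<le> \<epsilon> * sqrt (2 * \<delta>)" using U(6)[OF k, of t x] by (simp add: Vu)
    then show ?thesis using \<epsilon>r[of "sqrt (2 * \<delta>)"] \<delta>(2) by simp
  qed
  have Vs0: "\<bar>V 0 t x\<bar> \<le> s0" for t x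
  proof -
    have "\<bar>conv k (U t) x - 0\<bar> \<le> 2 * \<epsilon>" by (rule conv_approx_const[OF k U(2)]) (use U(5) in simp)
    then show ?thesis using eps by (simp add: V_def)
  qed
  have V1: "\<bar>V 0 t x\<bar> \<le> 1" for t x using Vs0[of t x] eps by simp
  have U1: "\<bar>U t x\<bar> \<le> 1" for t x using U(5)[of t x] eps by simp
  have err: "\<bar>Q 0 t x - f (V 0 t x)\<bar> \<le> \<eta>" for t x
  proof -
    have "\<bar>conv k (\<lambda>y. f (U t y)) x - f (V 0 t x)\<bar> \<le> \<eta>"
    proof (rule conv_approx_const[OF k fU_cont(2)])
      fix y assume "\<bar>y - x\<bar> \<le> \<delta>"
      then have "sqrt \<bar>y - x\<bar> \<le> r" using \<delta>(3) real_sqrt_le_mono order_trans by blast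
      then have "\<bar>U t y - U t x\<bar> < r" using U(4)[of t y x] \<epsilon>r by (meson le_less_trans)
      then have "\<bar>U t y - V 0 t x\<bar> < d" using VU[of t x] r(2) by linarith
      then show "\<bar>f (U t y) - f (V 0 t x)\<bar> \<le> \<eta>"
        using d(2)[of "V 0 t x" "U t y"] U1[of t y] V1[of t x] by force
    qed
    then show ?thesis by (simp add: Q_def)
  qed
  have mass: "integral {-L..L} (\<lambda>x. (V 0 t x)\<^sup>2) \<le> 1/16" "integral {-L..L} (\<lambda>x. (V 1 t x)\<^sup>2) \<le> 1/16" for t
  proof -
    have le: "integral {-L..L} (\<lambda>x. (V n t x)\<^sup>2) \<le> 1/16"
      if Vn: "V n t = conv k g" and g: "in_L2 g" "L2_norm g \<le> H1_norm (u t)" for n g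
    proof -
      have "integral {-L..L} (\<lambda>x. (V n t x)\<^sup>2) \<le> (L2_norm (V n t))\<^sup>2"
        using Vn conv_L2(1)[OF k g(1)] by (intro integral_le_L2_norm Vt) simp
      also have "\<dots> \<le> (1/4)\<^sup>2"
        using Vn conv_L2(2)[OF k g(1)] g(2) bd[of t] eps by (intro power_mono) auto
      finally show ?thesis by (simp add: power2_eq_square)
    qed
    show "integral {-L..L} (\<lambda>x. (V 0 t x)\<^sup>2) \<le> 1/16"
      by (rule le[OF _ u_L2 L2_norm_le_H1_norm(1)]) (simp add: Vu)
    show "integral {-L..L} (\<lambda>x. (V 1 t x)\<^sup>2) \<le> 1/16"
      by (rule le[OF _ weak_derivative_spec(1)[OF H1] L2_norm_le_H1_norm(2)])
         (rule ext, simp add: Vu conv_deriv_eq[OF H1 k])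
  qed
  have FV: "continuous_on UNIV (\<lambda>x. f (V 0 t x))" "continuous_on UNIV (\<lambda>x. F (V 0 t x))" for t
    by (rule continuous_on_compose2[OF f Vt] continuous_on_compose2[OF cont[OF F] Vt], simp)+
  define G where "G t x = p x * V 0 t x * (V 3 t x + Q 1 t x)" for t x
  define N where "N t = integral {-L..L} (G t)" for t
  have Gc: "continuous_on UNIV (\<lambda>z. G (fst z) (snd z))"
    unfolding G_def by (intro continuous_intros Vc Qc continuous_on_compose2[OF pc(1)]) auto
  have Nc: "continuous_on UNIV N"
    unfolding N_def cbox_interval[symmetric]
    by (rule integral_continuous_on_param)
       (use Gc in \<open>auto simp: split_beta intro: continuous_on_subset\<close>)
  have Neq: "N t = integral {-L..L} (\<lambda>x. 3/2 * p1 x * (V 1 t x)\<^sup>2 - 1/2 * p3 x * (V 0 t x)\<^sup>2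
      - p1 x * (V 0 t x * f (V 0 t x) - F (V 0 t x))
      - (p1 x * V 0 t x + p x * V 1 t x) * (Q 0 t x - f (V 0 t x)))" for t
    unfolding N_def G_def
    by (rule energy_identity[OF L _ _ _ Vt _ Qt p(1-4) F f p(5-10)])
       (use V'[of 0 t] V'[of 1 t] V'[of 2 t] Q'[of 0 t] in \<open>simp_all add: eval_nat_numeral\<close>)
  \<comment> \<open>The order of integration is exchanged because the equation for v holds for each
    fixed x: there G is the time derivative of -(p/2) v^2, which takes the same value at both ends
    of the period.\<close>
  have "integral {a..a+\<omega>} N = integral (cbox a (a+\<omega>)) (\<lambda>t. integral (cbox (-L) L) (G t))"
    by (simp add: N_def[abs_def])
  also have "\<dots> = integral (cbox (-L) L) (\<lambda>x. integral (cbox a (a+\<omega>)) (\<lambda>t. G t x))"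
    by (rule integral_swap_continuous) (use Gc in \<open>auto simp: split_beta intro: continuous_on_subset\<close>)
  also have "\<dots> = integral (cbox (-L) L) (\<lambda>x. 0)"
  proof (rule Henstock_Kurzweil_Integration.integral_cong)
    fix x
    define E where "E t = - (p x / 2) * (V 0 t x * V 0 t x)" for t
    have "(E has_real_derivative G t x) (at t)" for t
      unfolding G_def E_def
      by (rule DERIV_cong[OF DERIV_cmult[OF DERIV_mult[OF Vt' Vt']]]) (simp add: algebra_simps)
    then have "((\<lambda>t. G t x) has_integral E (a + \<omega>) - E a) {a..a+\<omega>}"
      by (intro fundamental_theorem_of_calculus)
         (use \<omega> in \<open>auto simp: has_real_derivative_iff_has_vector_derivative[symmetric] intro: has_field_derivative_at_within\<close>)
    moreover have "U (a + \<omega>) = U a" using U_periodic by blast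
    ultimately show "integral (cbox a (a+\<omega>)) (\<lambda>t. G t x) = 0"
      by (simp add: E_def V_def has_integral_iff)
  qed
  finally have N0: "integral {a..a+\<omega>} N = 0" by simp
  have bound: "(\<zeta> x * (U t x)\<^sup>2)\<^sup>2 \<le> N t + (\<kappa> + 3 * \<kappa>\<^sup>2 + e + 4 * T * e)" for t
  proof -
    have "(\<zeta> x * (V 0 t x)\<^sup>2)\<^sup>2 \<le> N t + \<kappa> + 3 * \<kappa>\<^sup>2 + P * \<eta> * (4 * L + 1)"
      unfolding Neq
    proof (rule energy_lower_bound[OF L _ Vt V1 mass \<zeta>(1-5) pc p(11-14) _ _ _ err x])
      show "(V 0 t has_real_derivative V 1 t x) (at x)" for x using V'[of 0 t x] by simp
      show "continuous_on UNIV (\<lambda>x. V 0 t x * f (V 0 t x) - F (V 0 t x))"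
        "continuous_on UNIV (\<lambda>x. Q 0 t x - f (V 0 t x))"
        by (intro continuous_intros Vt FV Qt)+
      show "\<bar>V 0 t x * f (V 0 t x) - F (V 0 t x)\<bar> \<le> 4 * V 0 t x ^ 6" for x
        by (rule nonlin[OF Vs0])
    qed
    moreover have "(\<zeta> x * (U t x)\<^sup>2)\<^sup>2 \<le> (\<zeta> x * (V 0 t x)\<^sup>2)\<^sup>2 + 4 * T * e"
    proof -
      have "(U t x) ^ 4 \<le> (V 0 t x) ^ 4 + 4 * \<bar>U t x - V 0 t x\<bar>" by (rule power4_diff_le[OF U1 V1])
      also have "\<dots> \<le> (V 0 t x) ^ 4 + 4 * e" using VU[of t x] r(3) by simp
      finally have "(\<zeta> x)\<^sup>2 * (U t x) ^ 4 \<le> (\<zeta> x)\<^sup>2 * ((V 0 t x) ^ 4 + 4 * e)" by (intro mult_left_mono) auto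
      also have "\<dots> \<le> (\<zeta> x)\<^sup>2 * (V 0 t x) ^ 4 + T * (4 * e)"
        using \<zeta>(6)[of x] e by (simp add: distrib_left mult_right_mono)
      finally show ?thesis by (simp add: power_mult_distrib power_mult[symmetric])
    qed
    ultimately show ?thesis using \<eta>(2) by linarith
  qed
  have Nint: "N integrable_on {a..a+\<omega>}"
    by (rule integrable_continuous_real[OF continuous_on_subset[OF Nc]]) simp
  have "integral {a..a+\<omega>} (\<lambda>t. (\<zeta> x * (U t x)\<^sup>2)\<^sup>2) \<le>
      integral {a..a+\<omega>} (\<lambda>t. N t + (\<kappa> + 3 * \<kappa>\<^sup>2 + e + 4 * T * e))"
  proof (rule integral_le)
    show "(\<lambda>t. (\<zeta> x * (U t x)\<^sup>2)\<^sup>2) integrable_on {a..a+\<omega>}"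
      by (intro integrable_continuous_real continuous_intros
          continuous_on_subset[OF continuous_on_slice(2)[OF U(1), simplified]]) auto
    show "(\<lambda>t. N t + (\<kappa> + 3 * \<kappa>\<^sup>2 + e + 4 * T * e)) integrable_on {a..a+\<omega>}"
      by (intro integrable_add Nint) auto
  qed (rule bound)
  also have "\<dots> = \<omega> * (\<kappa> + 3 * \<kappa>\<^sup>2 + e + 4 * T * e)"
    using Nint \<omega> N0 by (subst Henstock_Kurzweil_Integration.integral_add) auto
  also have "\<dots> = \<omega> * (\<kappa> + 3 * \<kappa>\<^sup>2) + e0"
    using \<omega> T by (simp add: e_def field_simps add_nonneg_eq_0_iff)
  finally show "integral {a..a+\<omega>} (\<lambda>t. (\<zeta> x * (U t x)\<^sup>2)\<^sup>2) \<le> \<omega> * (\<kappa> + 3 * \<kappa>\<^sup>2) + e0" .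
qed

text \<open>For fixed x and R tending to infinity, b(x/R) tends to b(0) > 0 and \<kappa> = T/R to 0,
  so U(.,x)^4 integrates to 0 over a period. The period may start at any time, hence at
  \<open>a\<close>.\<close>

lemma U_eq_0: "U a x = 0"
proof -
  obtain b T where b: "continuous_on UNIV b" "0 < b 0" "0 < T"
    "\<And>x. 0 \<le> b x" "\<And>x. (b x)\<^sup>2 \<le> T"
    and w: "\<And>R. 1 \<le> R \<Longrightarrow> \<exists>\<zeta>1 p p1 p2 p3 P.
       (\<forall>x. ((\<lambda>x. b (x / R)) has_real_derivative \<zeta>1 x) (at x)) \<and> continuous_on UNIV \<zeta>1 \<and>
       (\<forall>x. \<bar>\<zeta>1 x\<bar> \<le> T / R) \<and> b (-(R\<^sup>2) / R) = 0 \<and>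
       (\<forall>x. (p has_real_derivative p1 x) (at x)) \<and> (\<forall>x. (p1 has_real_derivative p2 x) (at x)) \<and>
       (\<forall>x. (p2 has_real_derivative p3 x) (at x)) \<and> continuous_on UNIV p3 \<and>
       p (R\<^sup>2) = 0 \<and> p (-(R\<^sup>2)) = 0 \<and> p1 (R\<^sup>2) = 0 \<and> p1 (-(R\<^sup>2)) = 0 \<and> p2 (R\<^sup>2) = 0 \<and> p2 (-(R\<^sup>2)) = 0 \<and>
       (\<forall>x. \<bar>p1 x - (b (x / R))\<^sup>2\<bar> \<le> T / R) \<and> (\<forall>x. \<bar>p3 x\<bar> \<le> 2 * (T / R)) \<and>
       (\<forall>x. \<bar>p x\<bar> \<le> P) \<and> (\<forall>x. \<bar>p1 x\<bar> \<le> P)"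
    by (rule virial_weights) blast
  define J where "J = integral {a..a+\<omega>} (\<lambda>t. (U t x) ^ 4)"
  have bound: "(b (x / R))\<^sup>2 * J \<le> \<omega> * (T / R + 3 * (T / R)\<^sup>2)" if R: "1 + \<bar>x\<bar> \<le> R" for R
  proof -
    have "1 \<le> R" using R by linarith
    from w[OF this] obtain \<zeta>1 p p1 p2 p3 P where W:
      "\<And>x. ((\<lambda>x. b (x / R)) has_real_derivative \<zeta>1 x) (at x)" "continuous_on UNIV \<zeta>1"
      "\<And>x. \<bar>\<zeta>1 x\<bar> \<le> T / R" "b (-(R\<^sup>2) / R) = 0"
      "\<And>x. (p has_real_derivative p1 x) (at x)" "\<And>x. (p1 has_real_derivative p2 x) (at x)"
      "\<And>x. (p2 has_real_derivative p3 x) (at x)" "continuous_on UNIV p3"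
      "p (R\<^sup>2) = 0" "p (-(R\<^sup>2)) = 0" "p1 (R\<^sup>2) = 0" "p1 (-(R\<^sup>2)) = 0" "p2 (R\<^sup>2) = 0" "p2 (-(R\<^sup>2)) = 0"
      "\<And>x. \<bar>p1 x - (b (x / R))\<^sup>2\<bar> \<le> T / R" "\<And>x. \<bar>p3 x\<bar> \<le> 2 * (T / R)"
      "\<And>x. \<bar>p x\<bar> \<le> P" "\<And>x. \<bar>p1 x\<bar> \<le> P"
      by metis
    \<comment> \<open>Since |x| <= R <= R^2, the point x lies in the interval on which the weight
      lives.\<close>
    have "R * 1 \<le> R * R" using \<open>1 \<le> R\<close> by (intro mult_left_mono) auto
    then have "x \<in> {-(R\<^sup>2)..R\<^sup>2}" using R by (auto simp: power2_eq_square)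
    then have "integral {a..a+\<omega>} (\<lambda>t. (b (x / R) * (U t x)\<^sup>2)\<^sup>2) \<le> \<omega> * (T / R + 3 * (T / R)\<^sup>2)"
      by (rule localized_bound[where \<zeta> = "\<lambda>x. b (x / R)", OF zero_le_power2 W(1-4) b(4) b(5) W(5-18)])
    moreover have "(\<lambda>t. (b (x / R) * (U t x)\<^sup>2)\<^sup>2) = (\<lambda>t. (b (x / R))\<^sup>2 * (U t x) ^ 4)"
      by (simp add: power_mult_distrib power_mult[symmetric])
    ultimately show ?thesis by (simp add: J_def)
  qed
  have "(b 0)\<^sup>2 * J \<le> \<omega> * (0 + 3 * 0\<^sup>2)"
  proof (rule tendsto_le[OF _ _ _ eventually_mono[OF eventually_ge_at_top bound]])
    have 0: "((\<lambda>R. c / R) \<longlongrightarrow> 0) at_top" for c :: real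
      by (intro tendsto_divide_0[OF tendsto_const] filterlim_at_top_imp_at_infinity filterlim_ident)
    have "isCont b 0" using b(1) by (simp add: continuous_on_eq_continuous_at)
    then have "((\<lambda>R. b (x / R)) \<longlongrightarrow> b 0) at_top" by (rule isCont_tendsto_compose) (rule 0)
    then show "((\<lambda>R. (b (x / R))\<^sup>2 * J) \<longlongrightarrow> (b 0)\<^sup>2 * J) at_top" by (intro tendsto_intros)
    show "((\<lambda>R. \<omega> * (T / R + 3 * (T / R)\<^sup>2)) \<longlongrightarrow> \<omega> * (0 + 3 * 0\<^sup>2)) at_top"
      by (intro tendsto_intros 0)
  qed auto
  then have "J \<le> 0" using b(2) by (simp add: mult_le_0_iff)
  have Uc: "continuous_on {a..a+\<omega>} (\<lambda>t. (U t x) ^ 4)"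
    by (intro continuous_intros continuous_on_subset[OF continuous_on_slice(2)[OF U(1), simplified]]) auto
  moreover have "0 \<le> J"
    unfolding J_def by (intro Henstock_Kurzweil_Integration.integral_nonneg integrable_continuous_real Uc) auto
  ultimately have "\<forall>t\<in>{a..a+\<omega>}. (U t x) ^ 4 = 0"
    using integral_eq_0_iff[of a "a+\<omega>" "\<lambda>t. (U t x) ^ 4"] \<open>J \<le> 0\<close> \<omega> by (auto simp: J_def)
  then show ?thesis using \<omega> by auto
qed

end

lemma small_periodic_solution_eq_0:
  assumes f: "continuous_on UNIV f" and F: "\<And>s. (F has_real_derivative f s) (at s)"
    and nonlin: "\<And>s. \<bar>s\<bar> \<le> s0 \<Longrightarrow> \<bar>s * f s - F s\<bar> \<le> 4 * s ^ 6"
    and eps: "0 < \<epsilon>" "\<epsilon> \<le> 1/4" "2 * \<epsilon> \<le> s0" "s0 \<le> 1"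
    and H1: "\<And>t. in_H1 (u t)" and bd: "\<And>t. H1_norm (u t) \<le> \<epsilon>"
    and cont: "\<And>t. ((\<lambda>s. H1_norm (\<lambda>x. u s x - u t x)) \<longlongrightarrow> 0) (at t)"
    and sol: "solves_gKdV f u" and per: "0 < \<omega>" "\<And>t. AE x in lborel. u (t + \<omega>) x = u t x"
  shows "AE x in lborel. u t x = 0"
proof -
  obtain U where U: "continuous_on UNIV (\<lambda>p. U (fst p) (snd p))" "\<And>t. continuous_on UNIV (U t)"
    "\<And>t. AE x in lborel. u t x = U t x"
    "\<And>t a b. \<bar>U t b - U t a\<bar> \<le> \<epsilon> * sqrt \<bar>b - a\<bar>" "\<And>t x. \<bar>U t x\<bar> \<le> 2 * \<epsilon>"
    "\<And>t \<delta> k x. mollifier \<delta> k \<Longrightarrow> \<bar>conv k (u t) x - U t x\<bar> \<le> \<epsilon> * sqrt (2 * \<delta>)"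
    using H1_curve_continuous_representative[OF H1 bd cont] by blast
  interpret small_periodic_gKdV f F u U \<epsilon> s0 \<omega>
    by unfold_locales (fact assms U)+
  show ?thesis using U(3)[of t] by (simp add: U_eq_0)
qed

text \<open>Near 0 one has |f(s)| <= 2 |s|^j <= 2 |s|^5, and the mean value theorem gives |F(s)| <=
  2 s^6; the constant is 4 = 2 + 2.\<close>

lemma nonlinearity_small:
  fixes j :: nat and f\<^sub>j :: "real \<Rightarrow> real"
  assumes j: "j \<ge> 5" and C: "continuous_on UNIV f\<^sub>j"
    and lim: "((\<lambda>s. f\<^sub>j s / \<bar>s\<bar> ^ j) \<longlongrightarrow> 0) (at 0)"
    and F: "\<And>s. (F has_real_derivative s ^ j + f\<^sub>j s) (at s)" "F 0 = 0"
  obtains s0 where "0 < s0" "s0 \<le> 1"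
    "\<And>s. \<bar>s\<bar> \<le> s0 \<Longrightarrow> \<bar>s * (s ^ j + f\<^sub>j s) - F s\<bar> \<le> 4 * s ^ 6"
proof -
  \<comment> \<open>The limit is over s distinct from 0, so the value at 0 has to come from
    continuity: f_j(s) tends to 0 as well as to f_j(0).\<close>
  have "((\<lambda>s. f\<^sub>j s / \<bar>s\<bar> ^ j * \<bar>s\<bar> ^ j) \<longlongrightarrow> 0 * \<bar>0\<bar> ^ j) (at 0)"
    by (intro tendsto_intros lim)
  moreover have "eventually (\<lambda>s. f\<^sub>j s / \<bar>s\<bar> ^ j * \<bar>s\<bar> ^ j = f\<^sub>j s) (at 0)"
    by (simp add: eventually_at_filter)
  ultimately have "(f\<^sub>j \<longlongrightarrow> 0) (at 0)" using Lim_transform_eventually by fastforce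
  moreover have "(f\<^sub>j \<longlongrightarrow> f\<^sub>j 0) (at 0)" using C by (auto simp: continuous_on_def)
  ultimately have f0: "f\<^sub>j 0 = 0" using tendsto_unique[OF trivial_limit_at] by blast
  have "eventually (\<lambda>s. \<bar>f\<^sub>j s / \<bar>s\<bar> ^ j\<bar> < 1) (at 0)"
    using order_tendstoD(2)[OF tendsto_rabs[OF lim], of 1] by simp
  then obtain d where d: "0 < d" "\<And>s. s \<noteq> 0 \<Longrightarrow> \<bar>s\<bar> < d \<Longrightarrow> \<bar>f\<^sub>j s / \<bar>s\<bar> ^ j\<bar> < 1"
    unfolding eventually_at by (auto simp: dist_real_def)
  define s0 where "s0 = min 1 (d / 2)"
  have s0: "0 < s0" "s0 \<le> 1" "s0 < d" using d(1) by (auto simp: s0_def)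
  have bd: "\<bar>s ^ j + f\<^sub>j s\<bar> \<le> 2 * \<bar>s\<bar> ^ 5" if s: "\<bar>s\<bar> \<le> s0" for s
  proof (cases "s = 0")
    case True
    then show ?thesis using f0 j by (simp add: power_0_left)
  next
    case False
    then have "\<bar>f\<^sub>j s\<bar> < \<bar>s\<bar> ^ j"
      using d(2)[of s] s s0 by (simp add: abs_divide divide_less_eq power_abs)
    then have "\<bar>s ^ j + f\<^sub>j s\<bar> \<le> 2 * \<bar>s\<bar> ^ j" by (simp add: power_abs[symmetric])
    also have "\<bar>s\<bar> ^ j \<le> \<bar>s\<bar> ^ 5" using j s s0 by (intro power_decreasing) auto
    finally show ?thesis by simp
  qed
  have "\<bar>s * (s ^ j + f\<^sub>j s) - F s\<bar> \<le> 4 * s ^ 6" if s: "\<bar>s\<bar> \<le> s0" for s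
  proof -
    have six: "\<bar>s\<bar> * \<bar>s\<bar> ^ 5 = s ^ 6"
      using power_Suc[of "\<bar>s\<bar>" 5] power_even_abs[of 6 s] by simp
    \<comment> \<open>Taking z between 0 and s keeps it in the range where the bound on f is
      known.\<close>
    have "\<exists>z. \<bar>z\<bar> \<le> \<bar>s\<bar> \<and> F s = s * (z ^ j + f\<^sub>j z)"
    proof (cases s "0 :: real" rule: linorder_cases)
      case less
      obtain z where "s < z" "z < 0" "F 0 - F s = (0 - s) * (z ^ j + f\<^sub>j z)"
        using MVT2[OF less F(1)] by blast
      then show ?thesis using F(2) by (intro exI[of _ z]) simp
    next
      case greater
      obtain z where "0 < z" "z < s" "F s - F 0 = (s - 0) * (z ^ j + f\<^sub>j z)"
        using MVT2[OF greater F(1)] by blast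
      then show ?thesis using F(2) by (intro exI[of _ z]) simp
    qed (use F(2) in auto)
    then obtain z where z: "\<bar>z\<bar> \<le> \<bar>s\<bar>" "F s = s * (z ^ j + f\<^sub>j z)" by blast
    have "\<bar>F s\<bar> \<le> \<bar>s\<bar> * (2 * \<bar>z\<bar> ^ 5)"
      unfolding z(2) abs_mult using bd[of z] z(1) s by (intro mult_left_mono) auto
    also have "\<dots> \<le> \<bar>s\<bar> * (2 * \<bar>s\<bar> ^ 5)" using z(1) by (intro mult_left_mono power_mono) auto
    finally have 1: "\<bar>F s\<bar> \<le> 2 * s ^ 6" using six by simp
    have "\<bar>s * (s ^ j + f\<^sub>j s)\<bar> \<le> \<bar>s\<bar> * (2 * \<bar>s\<bar> ^ 5)"
      unfolding abs_mult using bd[OF s] by (intro mult_left_mono) auto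
    then have "\<bar>s * (s ^ j + f\<^sub>j s)\<bar> \<le> 2 * s ^ 6" using six by simp
    with 1 show ?thesis by linarith
  qed
  then show thesis using that s0 by blast
qed

theorem theorem1p3:
  fixes j :: nat and f\<^sub>j :: "real \<Rightarrow> real"
  assumes "j \<ge> 5"
    and "class_C j f\<^sub>j"
    and "((\<lambda>s. f\<^sub>j s / \<bar>s\<bar> ^ j) \<longlongrightarrow> 0) (at 0)"
  shows "\<exists>\<epsilon>::real. \<epsilon> > 0 \<and>
    (\<forall>(u\<^sub>0 :: real \<Rightarrow> real) (u :: real \<Rightarrow> real \<Rightarrow> real).
       in_H1_weighted (1/2) u\<^sub>0 \<and>
       strong_solution (1/2) (\<lambda>s. s ^ j + f\<^sub>j s) u\<^sub>0 u \<and>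
       essentially_bounded_in_H1 u \<and>
       \<not> identically_zero u \<and>
       (SUP t. ereal (H1_norm (u t))) < ereal \<epsilon>
       \<longrightarrow> \<not> time_periodic u)"
proof -
  have fj: "continuous_on UNIV f\<^sub>j" using assms(2) by (rule class_C_imp_continuous)
  then have f: "continuous_on UNIV (\<lambda>s. s ^ j + f\<^sub>j s)" by (intro continuous_intros)
  then have "isCont (\<lambda>s. s ^ j + f\<^sub>j s) s" for s using continuous_on_eq_continuous_at open_UNIV by blast
  then obtain F0 where F0: "\<And>s. (F0 has_vector_derivative s ^ j + f\<^sub>j s) (at s)"
    using einterval_antiderivative[of "-\<infinity>" "\<infinity>" "\<lambda>s. s ^ j + f\<^sub>j s"] by auto
  define F where "F s = F0 s - F0 0" for s
  have F: "(F has_real_derivative s ^ j + f\<^sub>j s) (at s)" for s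
    using F0 unfolding F_def has_real_derivative_iff_has_vector_derivative
    by (auto intro!: derivative_eq_intros)
  obtain s0 where s0: "0 < s0" "s0 \<le> 1"
    "\<And>s. \<bar>s\<bar> \<le> s0 \<Longrightarrow> \<bar>s * (s ^ j + f\<^sub>j s) - F s\<bar> \<le> 4 * s ^ 6"
    using nonlinearity_small[OF assms(1) fj assms(3) F] by (auto simp: F_def)
  \<comment> \<open>s0 <= 1 gives \<epsilon> <= 1/4, and 2 \<epsilon> = s0/2 leaves the sup bound 2
    \<epsilon> of the representative within s0. Only \<open>s0\<close>, hence only j and f_j,
    enters.\<close>
  define \<epsilon> where "\<epsilon> = s0 / 4"
  have \<epsilon>: "0 < \<epsilon>" "\<epsilon> \<le> 1/4" "2 * \<epsilon> \<le> s0" using s0 by (auto simp: \<epsilon>_def)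
  show ?thesis
  proof (rule exI[of _ \<epsilon>], intro conjI allI impI notI \<epsilon>(1))
    fix u\<^sub>0 :: "real \<Rightarrow> real" and u :: "real \<Rightarrow> real \<Rightarrow> real"
    assume asm: "in_H1_weighted (1/2) u\<^sub>0 \<and> strong_solution (1/2) (\<lambda>s. s ^ j + f\<^sub>j s) u\<^sub>0 u \<and>
       essentially_bounded_in_H1 u \<and> \<not> identically_zero u \<and>
       (SUP t. ereal (H1_norm (u t))) < ereal \<epsilon>"
      and "time_periodic u"
    then obtain \<omega> where \<omega>: "0 < \<omega>" "\<And>t. AE x in lborel. u (t + \<omega>) x = u t x"
      unfolding time_periodic_def by blast
    have H1: "in_H1 (u t)" for t
      using asm by (auto simp: essentially_bounded_in_H1_def)
    have bd: "H1_norm (u t) \<le> \<epsilon>" for t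
    proof -
      have "ereal (H1_norm (u t)) \<le> (SUP t. ereal (H1_norm (u t)))" by (rule SUP_upper) simp
      also have "\<dots> < ereal \<epsilon>" using asm by blast
      finally show ?thesis by simp
    qed
    have cont: "((\<lambda>s. H1_norm (\<lambda>x. u s x - u t x)) \<longlongrightarrow> 0) (at t)" for t
    proof (rule Lim_null_comparison)
      show "((\<lambda>s. H1_weighted_norm (1/2) (\<lambda>x. u s x - u t x)) \<longlongrightarrow> 0) (at t)"
        using asm by (auto simp: strong_solution_def continuous_in_H1_weighted_def)
      show "\<forall>\<^sub>F s in at t. norm (H1_norm (\<lambda>x. u s x - u t x)) \<le> H1_weighted_norm (1/2) (\<lambda>x. u s x - u t x)"
        by (auto simp: H1_weighted_norm_def H1_norm_def intro!: always_eventually)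
    qed
    have "solves_gKdV (\<lambda>s. s ^ j + f\<^sub>j s) u" using asm by (simp add: strong_solution_def)
    from small_periodic_solution_eq_0[OF f F s0(3) \<epsilon> s0(2) H1 bd cont this \<omega>]
    have "identically_zero u" by (simp add: identically_zero_def)
    then show False using asm by blast
  qed
qed

end
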